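(* Let $M$ be a connected compact oriented triangulated three-dimensional manifold whose boundary has $m\ge 0$ connected components, let real coordinates $(x_A,y_A,z_A)$ in general position be assigned to all vertices $A$ of the triangulation, and let $\mathcal C$ and $\mathcal D$ be two sets of boundary edges of equal cardinality. Consider the sequence of vector spaces and linear mappings $$0\to \mathfrak e(3) \xrightarrow{f_1} (dx_{\mathrm{inner}})\oplus m\,\mathfrak e(3) \xrightarrow{f_2} (dl) \xrightarrow{f_3} (d\omega,d\alpha) \xrightarrow{f_4} (dx_{\mathrm{inner}}^* )\oplus m\,\mathfrak e(3)^* \xrightarrow{f_5} \mathfrak e(3)^*\to 0$$ associated with these data (spaces and mappings as defined in the context). Then $$f_2\circ f_1=0,\qquad f_3\circ f_2=0,\qquad f_4\circ f_3=0,\qquad f_5\circ f_4=0 .$$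
   Context: Inner vertices/edges are those not lying in $\partial M$; boundary vertices/edges are those lying in $\partial M$. Unperturbed coordinates. Each vertex $A$ is assigned a point $(x_A,y_A,z_A)\in\mathbb R^3$; these numbers are arbitrary, subject only to being in general position (generic) for all constructions. Each tetrahedron thereby becomes a Euclidean tetrahedron in $\mathbb R^3$ (images of different tetrahedra may intersect), with edge lengths $l$ and nonzero oriented volume $V$; $V$ is positive or negative according to whether the orientation from $M$ agrees with that of $\mathbb R^3$. Angles. The dihedral angles of a tetrahedron are functions of its six edge lengths near the unperturbed ones, taken with the sign of its oriented volume. For an inner edge $i$, the deficit angle $\omega_i$ is $2\pi$ minus the sum of signed dihedral angles at $i$ over all tetrahedra containing $i$ (modulo $2\pi$; it vanishes for lengths computed from vertex coordinates). For a boundary edge $i$, $\alpha_i$ is minus the sum of signed dihedral angles at $i$ over all tetrahedra containing $i$ (minus the inner dihedral angle of $M$ at $i$). One has the symmetry: the matrix of partial derivatives $\partial(\omega\text{ or }\alpha)_i/\partial l_j$ over all edges $i,j$ of $M$, taken at the unperturbed lengths, is symmetric. Spaces. $\mathfrak e(3)$ is the Lie algebra of infinitesimal isometries of $\mathbb R^3$, with the basis of three infinitesimal translations and three infinitesimal rotations. $(dx_{\mathrm{inner}})$ is the space of column vectors of coordinate differentials of all inner vertices. $m\,\mathfrak e(3)$ is the direct sum of $m$ copies of $\mathfrak e(3)$, one for each boundary component; its elements are the "sways" (infinitesimal Euclidean motions of each boundary component as a whole). $(dl)$ is the space of column vectors of length differentials of all inner edges and of the boundary edges in $\mathcal C$.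 $(d\omega,d\alpha)$ is the space of column vectors of the differentials $d\omega_i$ for all inner edges $i$ and $d\alpha_k$ for $k\in\mathcal D$. Stars denote dual spaces. Mappings (identified with matrices, all derivatives at the unperturbed coordinates). $f_1$ sends $a\in\mathfrak e(3)$ to the displacements $dx_{\mathrm{inner}}$ of the inner vertices under the infinitesimal motion $a$, together with $m$ identical sways $a$. $f_2$ sends displacements of inner vertices and sways of boundary components to the resulting changes of edge lengths (so $dl_i=0$ for boundary edges $i$). $f_3$ is the matrix of partial derivatives of $\omega_i$ ($i$ inner) and $\alpha_k$ ($k\in\mathcal D$) with respect to $l_j$ ($j$ inner or $j\in\mathcal C$), the lengths of boundary edges not in $\mathcal C$ being held fixed. $f_4=-(f_2^{\mathcal D})^{\mathrm T}$, where $f_2^{\mathcal D}$ is the matrix defined like $f_2$ but with $\mathcal D$ in place of $\mathcal C$. $f_5=f_1^{\mathrm T}$. *)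

theory Defs
  imports "HOL-Analysis.Analysis" "HOL-Combinatorics.Permutations"
begin

section \<open>Topological 3-manifolds with boundary\<close>

definition half_space :: "(real ^ 3) set" where
  "half_space = {y. 0 \<le> y $ 3}"

definition bchart :: "'p topology \<Rightarrow> 'p set \<Rightarrow> ('p \<Rightarrow> real ^ 3) \<Rightarrow> bool" where
  "bchart M U h \<longleftrightarrow>
     openin M U \<and> openin (top_of_set half_space) (h ` U) \<and>
     homeomorphic_map (subtopology M U) (top_of_set (h ` U)) h"

definition manifold3 :: "'p topology \<Rightarrow> bool" where
  "manifold3 M \<longleftrightarrow> Hausdorff_space M \<and> second_countable M \<and>
     (\<forall>p \<in> topspace M. \<exists>U h. p \<in> U \<and> bchart M U h)"

definition bdry :: "'p topology \<Rightarrow> 'p set" where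
  "bdry M = {p \<in> topspace M. \<exists>U h. p \<in> U \<and> bchart M U h \<and> h p $ 3 = 0}"

definition bdry_components :: "'p topology \<Rightarrow> 'p set set" where
  "bdry_components M = connected_components_of (subtopology M (bdry M))"


section \<open>Triangulations\<close>

text \<open>
  A cell \<open>s\<close> has the vertex set \<open>verts T s\<close> and the characteristic map \<open>chi T s\<close>, whose
  argument is the vector of barycentric coordinates. Cells are not identified with their
  vertex sets: different simplices of a triangulation may have the same vertices, but the
  vertices of one simplex are distinct (which any assignment of coordinates giving nonzero
  volumes enforces). Simplicial complexes are the case where \<open>verts T\<close> is injective.
\<close>

record ('p, 'v, 'c) triang =
  cells :: "'c set"
  verts :: "'c \<Rightarrow> 'v set"
  chi :: "'c \<Rightarrow> ('v \<Rightarrow> real) \<Rightarrow> 'p"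

definition simplex_on :: "'v set \<Rightarrow> ('v \<Rightarrow> real) set" where
  "simplex_on S = {w. (\<forall>v\<in>S. 0 \<le> w v) \<and> (\<forall>v. v \<notin> S \<longrightarrow> w v = 0) \<and> sum w S = 1}"

definition open_simplex_on :: "'v set \<Rightarrow> ('v \<Rightarrow> real) set" where
  "open_simplex_on S = {w \<in> simplex_on S. \<forall>v\<in>S. 0 < w v}"

definition cell_set :: "('p, 'v, 'c) triang \<Rightarrow> 'c \<Rightarrow> 'p set" where
  "cell_set T s = chi T s ` simplex_on (verts T s)"

definition is_face :: "('p, 'v, 'c) triang \<Rightarrow> 'c \<Rightarrow> 'c \<Rightarrow> bool" where
  "is_face T s t \<longleftrightarrow> s \<in> cells T \<and> t \<in> cells T \<and> verts T s \<subseteq> verts T t \<and>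
     (\<forall>w \<in> simplex_on (verts T s). chi T s w = chi T t w)"

definition triangulates :: "('p, 'v, 'c) triang \<Rightarrow> 'p topology \<Rightarrow> bool" where
  "triangulates T M \<longleftrightarrow>
     finite (cells T) \<and>
     (\<forall>s \<in> cells T. finite (verts T s) \<and> verts T s \<noteq> {} \<and>
        embedding_map (top_of_set (simplex_on (verts T s))) M (chi T s)) \<and>
     (\<forall>t \<in> cells T. \<forall>S. S \<noteq> {} \<and> S \<subseteq> verts T t \<longrightarrow> (\<exists>s. is_face T s t \<and> verts T s = S)) \<and>
     (\<forall>p \<in> topspace M. \<exists>!s. s \<in> cells T \<and> p \<in> chi T s ` open_simplex_on (verts T s)) \<and>
     (\<forall>s \<in> cells T. \<forall>t \<in> cells T. \<forall>v. verts T s = {v} \<and> verts T t = {v} \<longrightarrow> s = t)"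

definition vertices :: "('p, 'v, 'c) triang \<Rightarrow> 'v set" where
  "vertices T = (\<Union>s \<in> cells T. verts T s)"

definition edges :: "('p, 'v, 'c) triang \<Rightarrow> 'c set" where
  "edges T = {s \<in> cells T. card (verts T s) = 2}"

definition tetrahedra :: "('p, 'v, 'c) triang \<Rightarrow> 'c set" where
  "tetrahedra T = {s \<in> cells T. card (verts T s) = 4}"

definition vertex_in :: "('p, 'v, 'c) triang \<Rightarrow> 'v \<Rightarrow> 'p set \<Rightarrow> bool" where
  "vertex_in T A X \<longleftrightarrow> (\<exists>s \<in> cells T. verts T s = {A} \<and> cell_set T s \<subseteq> X)"

definition inner_vertices :: "('p, 'v, 'c) triang \<Rightarrow> 'p topology \<Rightarrow> 'v set" where
  "inner_vertices T M = {A \<in> vertices T. \<not> vertex_in T A (bdry M)}"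

definition bdry_edges :: "('p, 'v, 'c) triang \<Rightarrow> 'p topology \<Rightarrow> 'c set" where
  "bdry_edges T M = {e \<in> edges T. cell_set T e \<subseteq> bdry M}"

definition inner_edges :: "('p, 'v, 'c) triang \<Rightarrow> 'p topology \<Rightarrow> 'c set" where
  "inner_edges T M = edges T - bdry_edges T M"

text \<open>
  \<open>orn t [A,B,C,D]\<close> is \<open>1\<close> or \<open>-1\<close> according to whether the ordering of the vertices of the
  tetrahedron \<open>t\<close> is positive or negative. An orientation of the manifold amounts to a
  coherent choice: two tetrahedra induce opposite orientations on a common triangle.
\<close>

definition orients :: "('c \<Rightarrow> 'v list \<Rightarrow> int) \<Rightarrow> ('p, 'v, 'c) triang \<Rightarrow> bool" where
  "orients orn T \<longleftrightarrow>
     (\<forall>t \<in> tetrahedra T. \<forall>xs. distinct xs \<and> set xs = verts T t \<longrightarrow>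
        orn t xs \<in> {1, -1} \<and>
        (\<forall>\<pi>. \<pi> permutes {..<4} \<longrightarrow> orn t (permute_list \<pi> xs) = sign \<pi> * orn t xs)) \<and>
     (\<forall>t \<in> tetrahedra T. \<forall>t' \<in> tetrahedra T. \<forall>f A B C D D'.
        t \<noteq> t' \<and> is_face T f t \<and> is_face T f t' \<and>
        card (verts T f) = 3 \<and> verts T f = {A, B, C} \<and>
        verts T t = {A, B, C, D} \<and> verts T t' = {A, B, C, D'} \<longrightarrow>
        orn t [A, B, C, D] = - orn t' [A, B, C, D'])"


section \<open>Euclidean geometry: volumes, lengths and angles\<close>

text \<open>
  The descriptions with \<open>THE\<close> below range over all ways to name the vertices of an edge or a
  tetrahedron; the value does not depend on the naming.
\<close>

definition oriented_volume ::
  "('p, 'v, 'c) triang \<Rightarrow> ('c \<Rightarrow> 'v list \<Rightarrow> int) \<Rightarrow> ('v \<Rightarrow> real ^ 3) \<Rightarrow> 'c \<Rightarrow> real" where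
  "oriented_volume T orn x t =
     (THE V. \<exists>A B C D. verts T t = {A, B, C, D} \<and>
        V = of_int (orn t [A, B, C, D]) *
              det (vector [x B - x A, x C - x A, x D - x A] :: real ^ 3 ^ 3) / 6)"

text \<open>
  Genericity of the coordinates is needed only for the Euclidean tetrahedra to be nondegenerate,
  so that lengths and dihedral angles are smooth.
\<close>

definition generic_coords ::
  "('p, 'v, 'c) triang \<Rightarrow> ('c \<Rightarrow> 'v list \<Rightarrow> int) \<Rightarrow> ('v \<Rightarrow> real ^ 3) \<Rightarrow> bool" where
  "generic_coords T orn x \<longleftrightarrow> (\<forall>t \<in> tetrahedra T. oriented_volume T orn x t \<noteq> 0)"

definition edge_length :: "('p, 'v, 'c) triang \<Rightarrow> ('v \<Rightarrow> real ^ 3) \<Rightarrow> 'c \<Rightarrow> real" where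
  "edge_length T x e = (THE d. \<exists>A B. verts T e = {A, B} \<and> d = dist (x A) (x B))"

definition perp_part :: "real ^ 3 \<Rightarrow> real ^ 3 \<Rightarrow> real ^ 3" where
  "perp_part u v = v - ((v \<bullet> u) / (u \<bullet> u)) *\<^sub>R u"

text \<open>The angle at the edge \<open>ab\<close> between the half-planes containing \<open>c\<close> and \<open>d\<close>.\<close>

definition dihedral_angle :: "real ^ 3 \<Rightarrow> real ^ 3 \<Rightarrow> real ^ 3 \<Rightarrow> real ^ 3 \<Rightarrow> real" where
  "dihedral_angle a b c d =
     (let v = perp_part (b - a) (c - a); w = perp_part (b - a) (d - a)
      in arccos ((v \<bullet> w) / (norm v * norm w)))"

definition realizes_lengths ::
  "('p, 'v, 'c) triang \<Rightarrow> ('c \<Rightarrow> real) \<Rightarrow> 'c \<Rightarrow> ('v \<Rightarrow> real ^ 3) \<Rightarrow> bool" where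
  "realizes_lengths T l t y \<longleftrightarrow> (\<forall>e \<in> edges T. is_face T e t \<longrightarrow> edge_length T y e = l e)"

text \<open>
  The dihedral angle at the edge \<open>e\<close> of a Euclidean tetrahedron with the edge lengths
  prescribed by \<open>l\<close>, as a function of \<open>l\<close>; it is meaningful when such a tetrahedron exists, in
  particular for all \<open>l\<close> near the lengths of a nondegenerate tetrahedron.
\<close>

definition dihedral_of_lengths ::
  "('p, 'v, 'c) triang \<Rightarrow> ('c \<Rightarrow> real) \<Rightarrow> 'c \<Rightarrow> 'c \<Rightarrow> real" where
  "dihedral_of_lengths T l t e =
     (THE \<theta>. \<exists>y A B C D. realizes_lengths T l t y \<and>
        verts T e = {A, B} \<and> verts T t = {A, B, C, D} \<and>
        \<theta> = dihedral_angle (y A) (y B) (y C) (y D))"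

definition signed_angle_sum ::
  "('p, 'v, 'c) triang \<Rightarrow> ('c \<Rightarrow> 'v list \<Rightarrow> int) \<Rightarrow> ('v \<Rightarrow> real ^ 3) \<Rightarrow> ('c \<Rightarrow> real) \<Rightarrow> 'c \<Rightarrow> real" where
  "signed_angle_sum T orn x l i =
     (\<Sum>t \<in> {t \<in> tetrahedra T. is_face T i t}.
        sgn (oriented_volume T orn x t) * dihedral_of_lengths T l t i)"

text \<open>
  \<open>\<omega>\<^sub>i\<close> for inner edges and \<open>\<alpha>\<^sub>i\<close> for boundary edges. The deficit angle is defined modulo
  \<open>2 * pi\<close>; only its derivatives matter, so a real-valued representative is used.
\<close>

definition omega_alpha ::
  "('p, 'v, 'c) triang \<Rightarrow> 'p topology \<Rightarrow> ('c \<Rightarrow> 'v list \<Rightarrow> int) \<Rightarrow> ('v \<Rightarrow> real ^ 3) \<Rightarrow>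
   ('c \<Rightarrow> real) \<Rightarrow> 'c \<Rightarrow> real" where
  "omega_alpha T M orn x l i =
     (if i \<in> inner_edges T M then 2 * pi - signed_angle_sum T orn x l i
      else - signed_angle_sum T orn x l i)"


section \<open>The spaces and the mappings\<close>

text \<open>
  Column vectors indexed by a set \<open>I\<close>, and the linear map from columns indexed by \<open>J\<close> to
  columns indexed by \<open>I\<close> given by an \<open>I\<close> by \<open>J\<close> matrix. A dual space is described in the dual
  basis, hence by columns over the same index set.
\<close>

definition colvecs :: "'i set \<Rightarrow> ('i \<Rightarrow> real) set" where
  "colvecs I = {v. \<forall>i. i \<notin> I \<longrightarrow> v i = 0}"

definition mat_map :: "'i set \<Rightarrow> 'j set \<Rightarrow> ('i \<Rightarrow> 'j \<Rightarrow> real) \<Rightarrow> ('j \<Rightarrow> real) \<Rightarrow> 'i \<Rightarrow> real" where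
  "mat_map I J A v = (\<lambda>i. if i \<in> I then (\<Sum>j\<in>J. A i j * v j) else 0)"

text \<open>
  Basis of \<open>\<ee>(3)\<close>: three translations (\<open>Inl\<close>) and three rotations (\<open>Inr\<close>), acting on
  \<open>\<real>\<^sup>3\<close> as vector fields.
\<close>

type_synonym e3_basis = "3 + 3"

fun e3_field :: "e3_basis \<Rightarrow> real ^ 3 \<Rightarrow> real ^ 3" where
  "e3_field (Inl k) y = axis k 1"
| "e3_field (Inr k) y = cross3 (axis k 1) y"

definition e3_index :: "e3_basis set" where
  "e3_index = UNIV"

text \<open>
  Basis of the direct sum of \<open>(dx\<^sub>i\<^sub>n\<^sub>n\<^sub>e\<^sub>r)\<close> and \<open>m \<ee>(3)\<close>: a coordinate of an inner vertex, or a
  basis element of the copy of \<open>\<ee>(3)\<close> belonging to a boundary component.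
\<close>

type_synonym ('v, 'p) motion_basis = "('v \<times> 3) + ('p set \<times> e3_basis)"

definition motion_index ::
  "('p, 'v, 'c) triang \<Rightarrow> 'p topology \<Rightarrow> ('v, 'p) motion_basis set" where
  "motion_index T M = (inner_vertices T M \<times> UNIV) <+> (bdry_components M \<times> UNIV)"

definition edge_index :: "('p, 'v, 'c) triang \<Rightarrow> 'p topology \<Rightarrow> 'c set \<Rightarrow> 'c set" where
  "edge_index T M \<C> = inner_edges T M \<union> \<C>"

text \<open>The velocities of all vertices under a basis motion.\<close>

fun velocity ::
  "('p, 'v, 'c) triang \<Rightarrow> ('v \<Rightarrow> real ^ 3) \<Rightarrow> ('v, 'p) motion_basis \<Rightarrow> 'v \<Rightarrow> real ^ 3" where
  "velocity T x (Inl (A, k)) B = (if B = A then axis k 1 else 0)"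
| "velocity T x (Inr (c, g)) B = (if vertex_in T B c then e3_field g (x B) else 0)"

fun F1 :: "('v \<Rightarrow> real ^ 3) \<Rightarrow> ('v, 'p) motion_basis \<Rightarrow> e3_basis \<Rightarrow> real" where
  "F1 x (Inl (A, k)) g = e3_field g (x A) $ k"
| "F1 x (Inr (c, h)) g = (if h = g then 1 else 0)"

definition F2 ::
  "('p, 'v, 'c) triang \<Rightarrow> ('v \<Rightarrow> real ^ 3) \<Rightarrow> 'c \<Rightarrow> ('v, 'p) motion_basis \<Rightarrow> real" where
  "F2 T x i q = deriv (\<lambda>s. edge_length T (\<lambda>A. x A + s *\<^sub>R velocity T x q A) i) 0"

definition F3 ::
  "('p, 'v, 'c) triang \<Rightarrow> 'p topology \<Rightarrow> ('c \<Rightarrow> 'v list \<Rightarrow> int) \<Rightarrow> ('v \<Rightarrow> real ^ 3) \<Rightarrow>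
   'c \<Rightarrow> 'c \<Rightarrow> real" where
  "F3 T M orn x i j =
     deriv (\<lambda>s. omega_alpha T M orn x ((edge_length T x)(j := s)) i) (edge_length T x j)"

definition f1 ::
  "('p, 'v, 'c) triang \<Rightarrow> 'p topology \<Rightarrow> ('v \<Rightarrow> real ^ 3) \<Rightarrow>
   (e3_basis \<Rightarrow> real) \<Rightarrow> ('v, 'p) motion_basis \<Rightarrow> real" where
  "f1 T M x = mat_map (motion_index T M) e3_index (F1 x)"

definition f2 ::
  "('p, 'v, 'c) triang \<Rightarrow> 'p topology \<Rightarrow> ('v \<Rightarrow> real ^ 3) \<Rightarrow> 'c set \<Rightarrow>
   (('v, 'p) motion_basis \<Rightarrow> real) \<Rightarrow> 'c \<Rightarrow> real" where
  "f2 T M x \<C> = mat_map (edge_index T M \<C>) (motion_index T M) (F2 T x)"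

definition f3 ::
  "('p, 'v, 'c) triang \<Rightarrow> 'p topology \<Rightarrow> ('c \<Rightarrow> 'v list \<Rightarrow> int) \<Rightarrow> ('v \<Rightarrow> real ^ 3) \<Rightarrow>
   'c set \<Rightarrow> 'c set \<Rightarrow> ('c \<Rightarrow> real) \<Rightarrow> 'c \<Rightarrow> real" where
  "f3 T M orn x \<C> \<D> = mat_map (edge_index T M \<D>) (edge_index T M \<C>) (F3 T M orn x)"

text \<open>The rows of \<open>F2\<close> over \<open>edge_index T M \<D>\<close> form the matrix of \<open>f2\<close> with \<open>\<D>\<close> in place of \<open>\<C>\<close>.\<close>

definition f4 ::
  "('p, 'v, 'c) triang \<Rightarrow> 'p topology \<Rightarrow> ('v \<Rightarrow> real ^ 3) \<Rightarrow> 'c set \<Rightarrow>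
   ('c \<Rightarrow> real) \<Rightarrow> ('v, 'p) motion_basis \<Rightarrow> real" where
  "f4 T M x \<D> = mat_map (motion_index T M) (edge_index T M \<D>) (\<lambda>q i. - F2 T x i q)"

definition f5 ::
  "('p, 'v, 'c) triang \<Rightarrow> 'p topology \<Rightarrow> ('v \<Rightarrow> real ^ 3) \<Rightarrow>
   (('v, 'p) motion_basis \<Rightarrow> real) \<Rightarrow> e3_basis \<Rightarrow> real" where
  "f5 T M x = mat_map e3_index (motion_index T M) (\<lambda>g q. F1 x q g)"

end

theory Submission
  imports Defs
begin

text \<open>
  Two of the four compositions express Euclidean invariance of lengths: an infinitesimal isometry
  changes no edge length (\<open>F2_F1\<close>), which gives \<open>f2 \<circ> f1 = 0\<close> and, transposed, \<open>f5 \<circ> f4 = 0\<close>.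

  The other two rest on the fact that the sum of the signed dihedral angles at an edge is
  stationary under every motion of the vertices that moves each boundary component rigidly
  (\<open>signed_angle_sum_stationary\<close>). Such a motion turns every half-plane bounded by the line of the
  edge \<open>AB\<close> about this line, at a certain speed relative to a frame that is parallel along the
  moving line. The dihedral angle of a tetrahedron \<open>ABCD\<close>, taken with the sign of its volume,
  changes at \<open>orn t [A, B, C, D]\<close> times the difference of the speeds of its two faces
  (\<open>dihedral_angle_has_derivative\<close>, \<open>angle_rate_of_motion\<close>). The sum over the tetrahedra
  around the edge is regrouped by the triangles at the edge. A triangle that lies in two tetrahedra
  receives opposite coefficients because the orientation is coherent, and coherence also rules out
  a third tetrahedron. A triangle that lies in only one tetrahedron is contained in the boundary
  (\<open>free_triangle_in_bdry\<close>); all such triangles at the edge belong to the same boundary component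
  and turn at a common speed, which may be subtracted beforehand since the two coefficients of a
  tetrahedron add up to zero.

  By the chain rule this says that \<open>F3\<close> annihilates the length changes of such motions, so that
  \<open>f3 \<circ> f2 = 0\<close>; the columns of boundary edges outside \<open>\<C>\<close> may be added freely because
  boundary edges keep their lengths. As the matrix \<open>F3\<close> is symmetric (\<open>F3_symmetric\<close>), the transposed
  statement is \<open>f4 \<circ> f3 = 0\<close>. The symmetry is checked one tetrahedron at a time. The cosine of a
  dihedral angle is an explicit algebraic function of the six squared edge lengths, and the
  equality of the two partial derivatives becomes a polynomial identity for two adjacent edges
  and is visible for two opposite edges.

  The topology of \<open>M\<close> enters through invariance of domain, in two ways: every edge lies in a tetrahedron
  (\<open>edge_in_tetrahedron\<close>), hence has positive length, and the boundary is closed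
  (\<open>openin_interior_points\<close>), so that a triangle whose interior lies in the boundary lies there
  with its edges.
\<close>

section \<open>Charts and invariance of domain\<close>

text \<open>
  By invariance of domain the image is open in \<open>\<real>\<^sup>3\<close>, so it would leave the half-space near a point of
  height zero.
\<close>

lemma open_image_in_half_space_positive:
  fixes g :: "real ^ 3 \<Rightarrow> real ^ 3"
  assumes "open W" "continuous_on W g" "inj_on g W" "g ` W \<subseteq> half_space" "y \<in> W"
  shows "g y $ 3 > 0"
proof (rule ccontr)
  assume "\<not> g y $ 3 > 0"
  moreover have "open (g ` W)"
    using invariance_of_domain assms(1-3) by blast
  then obtain e where e: "e > 0" "ball (g y) e \<subseteq> g ` W"
    using assms(5) by (meson imageI open_contains_ball)
  have "dist (g y) (g y - (e/2) *\<^sub>R axis 3 1) < e"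
    using e by (simp add: dist_norm)
  then have "g y - (e/2) *\<^sub>R axis 3 1 \<in> half_space"
    using e(2) assms(4) by (meson mem_ball subsetD)
  then have "g y $ 3 \<ge> e/2" by (simp add: half_space_def axis_def)
  ultimately show False using e by simp
qed

lemma open_half_space_positive_point:
  assumes "openin (top_of_set half_space) V" "y \<in> V"
  shows "\<exists>z \<in> V. z $ 3 > 0"
proof -
  obtain O' where O': "open O'" "V = half_space \<inter> O'" using assms(1) by (auto simp: openin_open)
  then obtain e where e: "e > 0" "ball y e \<subseteq> O'" using assms(2) by (meson IntD2 open_contains_ball)
  \<comment> \<open>Moving up by half the radius stays in the half-space and in the ball.\<close>
  let ?z = "y + (e/2) *\<^sub>R axis 3 1"
  have "dist y ?z < e" using e by (simp add: dist_norm)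
  moreover have "?z $ 3 > 0" using assms(2) O' e by (simp add: half_space_def axis_def add_nonneg_pos)
  ultimately show ?thesis using O' e by (intro bexI[of _ ?z]) (auto simp: half_space_def)
qed

lemma chart_image_open:
  assumes "bchart M U h" "openin M G" "G \<subseteq> U"
  shows "openin (top_of_set half_space) (h ` G)"
proof -
  have hm: "homeomorphic_map (subtopology M U) (top_of_set (h ` U)) h" and
    oU: "openin M U" and ohU: "openin (top_of_set half_space) (h ` U)"
    using assms by (auto simp: bchart_def)
  have "openin (subtopology M U) G"
    using assms by (metis inf.absorb_iff2 openin_subtopology inf_commute)
  then have "openin (top_of_set (h ` U)) (h ` G)"
    using homeomorphic_imp_open_map[OF hm] by (auto simp: open_map_def)
  then show ?thesis using ohU openin_trans by blast
qed

text \<open>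
  On the points of positive height, \<open>\<psi>\<close> composed with the inverse of the chart is a continuous
  injection of an open subset of \<open>\<real>\<^sup>3\<close>, to which the previous lemma applies. With a second chart as
  \<open>\<psi>\<close> this separates inner points from boundary points; with a map into a plane it is contradictory.
\<close>

lemma chart_positive_height:
  assumes ch: "bchart M U h" and G: "openin M G" "G \<subseteq> U"
    and \<psi>: "continuous_map (subtopology M G) euclidean \<psi>" "inj_on \<psi> G" "\<psi> ` G \<subseteq> half_space"
    and q: "q \<in> G" "h q $ 3 > 0"
  shows "(\<psi> q :: real ^ 3) $ 3 > 0"
proof -
  have hm: "homeomorphic_map (subtopology M U) (top_of_set (h ` U)) h" and
    oU: "openin M U" and ohU: "openin (top_of_set half_space) (h ` U)"
    using ch by (auto simp: bchart_def)
  have UM: "U \<subseteq> topspace M" and GM: "G \<subseteq> topspace M" using oU G openin_subset by auto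
  obtain k where k: "homeomorphic_maps (subtopology M U) (top_of_set (h ` U)) h k"
    using hm homeomorphic_map_maps by blast
  have kh: "k (h p) = p" if "p \<in> U" for p
    using k that UM by (auto simp: homeomorphic_maps_def)
  have ck: "continuous_map (top_of_set (h ` U)) M k"
    using k by (auto simp: homeomorphic_maps_def continuous_map_in_subtopology)
  have "openin (top_of_set half_space) (h ` G)"
    using chart_image_open[OF ch G] .
  then obtain O' where O': "open O'" "h ` G = half_space \<inter> O'" by (auto simp: openin_open)
  \<comment> \<open>A set that is open in \<open>\<real>\<^sup>3\<close> and not only in the half-space, as invariance of domain requires.\<close>
  define W where "W = O' \<inter> {y. y $ 3 > 0}"
  have "open {y :: real ^ 3. y $ 3 > 0}"
    by (intro open_Collect_less continuous_intros)
  then have "open W" unfolding W_def using O' by blast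
  have WG: "W \<subseteq> h ` G" using O' by (auto simp: W_def half_space_def)
  have "continuous_map (top_of_set W) (subtopology M G) k"
    unfolding continuous_map_in_subtopology
  proof
    show "continuous_map (top_of_set W) M k"
      using ck WG G(2) by (meson continuous_map_from_subtopology_mono image_mono order_trans)
    show "k \<in> topspace (top_of_set W) \<rightarrow> G" using WG kh G(2) by fastforce
  qed
  then have "continuous_map (top_of_set W) euclidean (\<psi> \<circ> k)"
    using \<psi>(1) continuous_map_compose by blast
  then have 1: "continuous_on W (\<psi> \<circ> k)" by simp
  have 2: "inj_on (\<psi> \<circ> k) W"
  proof (rule inj_onI)
    fix y z assume yz: "y \<in> W" "z \<in> W" "(\<psi> \<circ> k) y = (\<psi> \<circ> k) z"
    then obtain a b where "a \<in> G" "b \<in> G" "y = h a" "z = h b" using WG by blast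
    moreover from this have "k (h a) = a" "k (h b) = b" using kh G(2) by auto
    ultimately have "\<psi> a = \<psi> b" using yz by simp
    moreover note \<open>a \<in> G\<close> \<open>b \<in> G\<close> \<open>y = h a\<close> \<open>z = h b\<close>
    ultimately show "y = z" using \<psi>(2) by (auto dest: inj_onD)
  qed
  have 3: "(\<psi> \<circ> k) ` W \<subseteq> half_space" using WG kh G(2) \<psi>(3) by fastforce
  have "h q \<in> W" using q O' by (auto simp: W_def)
  from open_image_in_half_space_positive[OF \<open>open W\<close> 1 2 3 this] show ?thesis
    using kh q G(2) by auto
qed

text \<open>
  A point of \<open>bdry M\<close> is one that some chart sends to the bounding plane. By
  \<open>chart_positive_height\<close> no point of the chart domain with positive height is of this
  kind, and these points are an open neighbourhood of any given interior point.
\<close>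

lemma openin_interior_points:
  assumes "manifold3 M"
  shows "openin M (topspace M - bdry M)"
proof (subst openin_subopen, intro ballI)
  fix p assume p: "p \<in> topspace M - bdry M"
  then obtain U h where U: "p \<in> U" "bchart M U h" using assms by (auto simp: manifold3_def)
  have oU: "openin M U" and hm: "homeomorphic_map (subtopology M U) (top_of_set (h ` U)) h"
    and ohU: "openin (top_of_set half_space) (h ` U)" using U by (auto simp: bchart_def)
  have UM: "U \<subseteq> topspace M" using oU openin_subset by auto
  have nn: "h q $ 3 \<ge> 0" if "q \<in> U" for q
    using openin_subset[OF ohU] that by (auto simp: half_space_def)
  define N where "N = {q \<in> U. h q $ 3 > 0}"
  have "continuous_map (subtopology M U) (top_of_set (h ` U)) h"
    using hm homeomorphic_imp_continuous_map by blast
  then have "continuous_map (subtopology M U) euclidean h"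
    using continuous_map_into_fulltopology by blast
  moreover have "openin euclidean {y :: real ^ 3. y $ 3 > 0}"
    by (simp, intro open_Collect_less continuous_intros)
  ultimately have "openin (subtopology M U) {q \<in> topspace (subtopology M U). h q \<in> {y. y $ 3 > 0}}"
    by (rule openin_continuous_map_preimage)
  moreover have "{q \<in> topspace (subtopology M U). h q \<in> {y. y $ 3 > 0}} = N"
    using UM by (auto simp: N_def)
  ultimately have "openin M N" using oU openin_trans_full by fastforce
  moreover have "p \<in> N"
    using p U nn[of p] by (force simp: N_def bdry_def less_le)
  moreover have "q \<notin> bdry M" if q: "q \<in> N" for q
  proof
    assume "q \<in> bdry M"
    then obtain U' h' where U': "q \<in> U'" "bchart M U' h'" "h' q $ 3 = 0" by (auto simp: bdry_def)
    have oU': "openin M U'" and hm': "homeomorphic_map (subtopology M U') (top_of_set (h' ` U')) h'"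
      and ohU': "openin (top_of_set half_space) (h' ` U')" using U' by (auto simp: bchart_def)
    have UM': "U' \<subseteq> topspace M" using oU' openin_subset by auto
    have "continuous_map (subtopology M U') euclidean h'"
      using hm' homeomorphic_imp_continuous_map continuous_map_into_fulltopology by blast
    then have "continuous_map (subtopology M (U \<inter> U')) euclidean h'"
      using continuous_map_from_subtopology_mono by blast
    moreover have "inj_on h' (U \<inter> U')"
      using homeomorphic_imp_injective_map[OF hm'] UM' by (auto simp: inj_on_def)
    moreover have "h' ` (U \<inter> U') \<subseteq> half_space" using openin_subset[OF ohU'] by auto
    ultimately have "h' q $ 3 > 0"
      using q U' chart_positive_height[OF U(2), of "U \<inter> U'" h' q] oU oU'
      by (auto simp: N_def)
    then show False using U' by simp
  qed
  ultimately show "\<exists>N. openin M N \<and> p \<in> N \<and> N \<subseteq> topspace M - bdry M"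
    using UM by (intro exI[of _ N]) (auto simp: N_def)
qed

section \<open>Simplices and cells\<close>

lemma simplex_on_mono:
  assumes "finite S" "R \<subseteq> S"
  shows "simplex_on R \<subseteq> simplex_on S"
proof
  fix w assume w: "w \<in> simplex_on R"
  have "sum w S = sum w R"
    using assms w by (intro sum.mono_neutral_right) (auto simp: simplex_on_def)
  then show "w \<in> simplex_on S" using w assms by (force simp: simplex_on_def)
qed

lemma simplex_on_le_1:
  assumes "finite S" "w \<in> simplex_on S"
  shows "w v \<le> 1"
proof (cases "v \<in> S")
  case True
  then have "w v \<le> sum w S" using assms by (intro member_le_sum) (auto simp: simplex_on_def)
  then show ?thesis using assms by (simp add: simplex_on_def)
qed (use assms in \<open>auto simp: simplex_on_def\<close>)

lemma compact_simplex_on: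
  assumes "finite S"
  shows "compact (simplex_on S)"
proof -
  let ?P = "PiE UNIV (\<lambda>v. if v \<in> S then {0..1::real} else {0})"
  have "compactin (product_topology (\<lambda>v. euclidean) UNIV) ?P"
    unfolding compactin_PiE by auto
  then have c: "compact ?P" by (simp add: euclidean_product_topology)
  have "closed {w :: 'a \<Rightarrow> real. sum w S = 1}"
    by (intro closed_Collect_eq continuous_intros) auto
  then have "compact (?P \<inter> {w. sum w S = 1})" using c compact_Int_closed by blast
  moreover have "?P \<inter> {w. sum w S = 1} = simplex_on S"
    using simplex_on_le_1[OF assms] by (auto simp: simplex_on_def PiE_def Pi_def split: if_splits)
  ultimately show ?thesis by simp
qed

definition segment_to :: "('v \<Rightarrow> real) \<Rightarrow> ('v \<Rightarrow> real) \<Rightarrow> real \<Rightarrow> 'v \<Rightarrow> real" where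
  "segment_to w w' s = (\<lambda>v. (1 - s) * w v + s * w' v)"

lemma segment_to_continuous: "continuous_on X (segment_to w w')"
  unfolding segment_to_def by (intro continuous_on_coordinatewise_then_product continuous_intros)

lemma segment_to_in_simplex:
  assumes "w \<in> simplex_on S" "w' \<in> simplex_on S" "0 \<le> s" "s \<le> 1"
  shows "segment_to w w' s \<in> simplex_on S"
  using assms by (auto simp: simplex_on_def segment_to_def sum.distrib simp flip: sum_distrib_left)

lemma connected_simplex_on: "connected (simplex_on S)"
proof -
  have "\<exists>Z \<subseteq> simplex_on S. connected Z \<and> w \<in> Z \<and> w' \<in> Z"
    if "w \<in> simplex_on S" "w' \<in> simplex_on S" for w w'
  proof (intro exI[of _ "segment_to w w' ` {0..1}"] conjI)
    show "connected (segment_to w w' ` {0..1})"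
      by (intro connected_continuous_image segment_to_continuous) auto
    have "segment_to w w' 0 = w" "segment_to w w' 1 = w'" by (auto simp: segment_to_def)
    then show "w \<in> segment_to w w' ` {0..1}" "w' \<in> segment_to w w' ` {0..1}"
      by (metis atLeastAtMost_iff imageI zero_le_one order_refl)+
  qed (use segment_to_in_simplex[OF that] in auto)
  then have "connected_space (top_of_set (simplex_on S))"
    unfolding connected_space_subconnected by (simp add: connectedin_subtopology) blast
  then show ?thesis by (simp flip: connectedin_topspace add: connectedin_subtopology)
qed

lemma open_simplex_subset: "open_simplex_on S \<subseteq> simplex_on S"
  by (auto simp: open_simplex_on_def)

lemma open_simplex_on_nonempty:
  assumes "finite S" "S \<noteq> {}"
  shows "open_simplex_on S \<noteq> {}"
proof -
  have "(\<lambda>v. if v \<in> S then 1 / real (card S) else 0) \<in> open_simplex_on S"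
    using assms by (simp add: open_simplex_on_def simplex_on_def card_gt_0_iff)
  then show ?thesis by blast
qed

text \<open>
  One of the barycentric coordinates is determined by the others and may be left out of a chart.
\<close>

lemma simplex_on_eqI:
  assumes "finite S" "w \<in> simplex_on S" "w' \<in> simplex_on S" "\<And>v. v \<in> S - {C} \<Longrightarrow> w v = w' v"
  shows "w = w'"
proof
  fix v
  have "w C = w' C"
  proof (cases "C \<in> S")
    case True
    have "w C + sum w (S - {C}) = w' C + sum w' (S - {C})"
      using assms(1-3) True by (simp add: simplex_on_def flip: sum.remove)
    moreover have "sum w (S - {C}) = sum w' (S - {C})" using assms(4) by (intro sum.cong) auto
    ultimately show ?thesis by simp
  qed (use assms(2,3) in \<open>auto simp: simplex_on_def\<close>)
  then show "w v = w' v" using assms by (cases "v \<in> S - {C}") (auto simp: simplex_on_def)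
qed

lemma subset_three_points:
  assumes "finite S" "card S \<le> 3" "S \<noteq> {}"
  shows "\<exists>A B C. S \<subseteq> {A, B, C}"
proof -
  have "card S \<noteq> 0" using assms by simp
  then have "card S = 1 \<or> card S = 2 \<or> card S = 3" using assms(2) by linarith
  then show ?thesis
    by (auto simp: card_1_singleton_iff card_2_iff card_3_iff)
qed

locale triangulated_manifold =
  fixes M :: "'p topology" and T :: "('p, 'v, 'c) triang"
  assumes manifold: "manifold3 M" and triangulates: "triangulates T M"
begin

lemma finite_cells: "finite (cells T)"
  using triangulates by (simp add: triangulates_def)

lemma finite_verts: "s \<in> cells T \<Longrightarrow> finite (verts T s)"
  and verts_nonempty: "s \<in> cells T \<Longrightarrow> verts T s \<noteq> {}"
  and chi_embedding:
    "s \<in> cells T \<Longrightarrow> embedding_map (top_of_set (simplex_on (verts T s))) M (chi T s)"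
  using triangulates by (auto simp: triangulates_def)

lemma face_exists:
  "t \<in> cells T \<Longrightarrow> S \<noteq> {} \<Longrightarrow> S \<subseteq> verts T t \<Longrightarrow> \<exists>s. is_face T s t \<and> verts T s = S"
  using triangulates by (simp add: triangulates_def)

lemma vertex_cell_unique:
  "s \<in> cells T \<Longrightarrow> t \<in> cells T \<Longrightarrow> verts T s = {v} \<Longrightarrow> verts T t = {v} \<Longrightarrow> s = t"
  using triangulates by (auto simp: triangulates_def)

lemma chi_continuous:
  "s \<in> cells T \<Longrightarrow> continuous_map (top_of_set (simplex_on (verts T s))) M (chi T s)"
  using chi_embedding[of s] homeomorphic_imp_continuous_map continuous_map_into_fulltopology
  unfolding embedding_map_def by blast

lemma chi_in_topspace:
  "s \<in> cells T \<Longrightarrow> w \<in> simplex_on (verts T s) \<Longrightarrow> chi T s w \<in> topspace M"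
  using continuous_map_funspace[OF chi_continuous] by auto

lemma open_cell_unique:
  assumes "r \<in> cells T" "s \<in> cells T" "w \<in> open_simplex_on (verts T r)"
    "w' \<in> open_simplex_on (verts T s)" "chi T r w = chi T s w'"
  shows "r = s"
proof -
  have "chi T r w \<in> topspace M" using chi_in_topspace assms open_simplex_subset by blast
  then have "\<exists>!s. s \<in> cells T \<and> chi T r w \<in> chi T s ` open_simplex_on (verts T s)"
    using triangulates by (simp add: triangulates_def)
  then show ?thesis using assms by blast
qed

lemma open_cell_exists:
  assumes "p \<in> topspace M"
  obtains s w where "s \<in> cells T" "w \<in> open_simplex_on (verts T s)" "p = chi T s w"
proof -
  have "\<exists>!s. s \<in> cells T \<and> p \<in> chi T s ` open_simplex_on (verts T s)"
    using triangulates assms by (simp add: triangulates_def)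
  then show ?thesis using that by blast
qed

lemma face_refl: "s \<in> cells T \<Longrightarrow> is_face T s s"
  by (auto simp: is_face_def)

lemma face_cells: "is_face T s t \<Longrightarrow> s \<in> cells T" "is_face T s t \<Longrightarrow> t \<in> cells T"
  and face_verts: "is_face T s t \<Longrightarrow> verts T s \<subseteq> verts T t"
  and face_chi: "is_face T s t \<Longrightarrow> w \<in> simplex_on (verts T s) \<Longrightarrow> chi T s w = chi T t w"
  by (auto simp: is_face_def)

lemma face_simplex: "is_face T s t \<Longrightarrow> simplex_on (verts T s) \<subseteq> simplex_on (verts T t)"
  by (meson face_cells face_verts finite_verts simplex_on_mono)

lemma face_trans: "is_face T r s \<Longrightarrow> is_face T s t \<Longrightarrow> is_face T r t"
  using face_simplex[of r s] by (auto simp: is_face_def)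

lemma face_cell_set: "is_face T s t \<Longrightarrow> cell_set T s \<subseteq> cell_set T t"
  unfolding cell_set_def using face_chi[of s t] face_simplex[of s t] by auto

text \<open>
  Cells are not determined by their vertex sets, so inclusion of vertex sets makes a face only
  inside a common coface.
\<close>

lemma face_of_common:
  assumes "is_face T r t" "is_face T s t" "verts T r \<subseteq> verts T s"
  shows "is_face T r s"
  using assms simplex_on_mono[OF finite_verts[OF face_cells(1)[OF assms(2)]] assms(3)]
  by (auto simp: is_face_def)

lemma face_unique:
  assumes "is_face T r t" "is_face T s t" "verts T r = verts T s"
  shows "r = s"
proof -
  obtain w where w: "w \<in> open_simplex_on (verts T r)"
    using open_simplex_on_nonempty assms face_cells finite_verts verts_nonempty by (metis all_not_in_conv)
  have "chi T r w = chi T s w" using assms w open_simplex_subset by (metis face_chi subsetD)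
  then show ?thesis using open_cell_unique w assms by (metis face_cells(1))
qed

text \<open>
  Every point of a closed cell lies in the open cell of exactly one face: the one spanned by the vertices
  with positive weight.
\<close>

lemma carrier_face:
  assumes s: "s \<in> cells T" and w: "w \<in> simplex_on (verts T s)"
  shows "\<exists>r. is_face T r s \<and> verts T r = {v. w v > 0} \<and> w \<in> open_simplex_on (verts T r)
    \<and> chi T r w = chi T s w"
proof -
  define R where "R = {v. w v > 0}"
  have RS: "R \<subseteq> verts T s" using w by (force simp: R_def simplex_on_def)
  have z: "w v = 0" if "v \<notin> R" for v
    using that w by (cases "v \<in> verts T s") (auto simp: R_def simplex_on_def less_le)
  have "sum w (verts T s) = sum w R"
    using RS finite_verts[OF s] z by (intro sum.mono_neutral_right) auto
  then have sR: "sum w R = 1" using w by (simp add: simplex_on_def)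
  then have "R \<noteq> {}" by auto
  then obtain r where r: "is_face T r s" "verts T r = R" using face_exists[OF s] RS by blast
  have "w \<in> open_simplex_on R"
    unfolding open_simplex_on_def simplex_on_def
  proof (intro CollectI conjI ballI allI impI)
    fix v assume "v \<in> R"
    then show "0 < w v" "0 \<le> w v" unfolding R_def by auto
  qed (use sR z in blast)+
  then have "w \<in> open_simplex_on (verts T r)" using r by simp
  moreover from this have "w \<in> simplex_on (verts T r)" using open_simplex_subset by blast
  ultimately show ?thesis using r face_chi[OF r(1), of w] unfolding R_def by blast
qed

lemma face_if_meets_open_cell:
  assumes "f \<in> cells T" "w \<in> open_simplex_on (verts T f)" "s \<in> cells T" "chi T f w \<in> cell_set T s"
  shows "is_face T f s"
proof -
  obtain w' where w': "w' \<in> simplex_on (verts T s)" "chi T f w = chi T s w'"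
    using assms by (auto simp: cell_set_def)
  obtain r where r: "is_face T r s" "w' \<in> open_simplex_on (verts T r)" "chi T r w' = chi T s w'"
    using carrier_face[OF assms(3) w'(1)] by blast
  have "f = r" using open_cell_unique[OF assms(1) face_cells(1)[OF r(1)] assms(2) r(2)] w' r by simp
  then show ?thesis using r by simp
qed

lemma closedin_cell_set:
  assumes "s \<in> cells T"
  shows "closedin M (cell_set T s)"
proof -
  have "compactin (top_of_set (simplex_on (verts T s))) (simplex_on (verts T s))"
    using compact_simplex_on[OF finite_verts[OF assms]] by (simp add: compactin_subtopology)
  then have "compactin M (cell_set T s)"
    unfolding cell_set_def using chi_continuous[OF assms] by (rule image_compactin)
  then show ?thesis using manifold by (simp add: compactin_imp_closedin manifold3_def)
qed

text \<open>
  The open star of a cell: the finitely many closed cells that miss it form a closed set.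
\<close>

lemma openin_star:
  "openin M (\<Union>s \<in> {s. is_face T f s}. chi T s ` open_simplex_on (verts T s))" (is "openin M ?S")
proof -
  let ?C = "\<Union>(cell_set T ` {s \<in> cells T. \<not> is_face T f s})"
  have "closedin M ?C"
    using finite_cells closedin_cell_set by (intro closedin_Union) auto
  then have "openin M (topspace M - ?C)" by blast
  moreover have "topspace M - ?C = ?S"
  proof (intro set_eqI iffI)
    fix p assume p: "p \<in> topspace M - ?C"
    obtain s w where s: "s \<in> cells T" "w \<in> open_simplex_on (verts T s)" "p = chi T s w"
      using p open_cell_exists by blast
    then have "p \<in> cell_set T s" using open_simplex_subset by (auto simp: cell_set_def)
    then have "is_face T f s" using p s by blast
    then show "p \<in> ?S" using s by blast
  next
    fix p assume "p \<in> ?S"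
    then obtain s w where s: "is_face T f s" "w \<in> open_simplex_on (verts T s)" "p = chi T s w"
      by blast
    have "is_face T f r" if "r \<in> cells T" "p \<in> cell_set T r" for r
      using face_if_meets_open_cell[of s w r] s that face_cells face_trans by blast
    moreover have "p \<in> topspace M" using s chi_in_topspace open_simplex_subset face_cells by blast
    ultimately show "p \<in> topspace M - ?C" by blast
  qed
  ultimately show ?thesis by simp
qed


lemma cell_coordinates:
  assumes "s \<in> cells T" "X \<subseteq> simplex_on (verts T s)"
  obtains g where "homeomorphic_map (subtopology M (chi T s ` X)) (top_of_set X) g"
    "\<And>w. w \<in> X \<Longrightarrow> g (chi T s w) = w"
proof -
  have "homeomorphic_map (top_of_set (simplex_on (verts T s)))
     (subtopology M (chi T s ` simplex_on (verts T s))) (chi T s)"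
    using chi_embedding[OF assms(1)] by (simp add: embedding_map_def)
  moreover have "chi T s ` (topspace (top_of_set (simplex_on (verts T s))) \<inter> X) =
      topspace (subtopology M (chi T s ` simplex_on (verts T s))) \<inter> chi T s ` X"
    using assms chi_in_topspace[OF assms(1)] by auto
  ultimately have "homeomorphic_map (subtopology (top_of_set (simplex_on (verts T s))) X)
     (subtopology (subtopology M (chi T s ` simplex_on (verts T s))) (chi T s ` X)) (chi T s)"
    by (rule homeomorphic_map_subtopologies)
  then have "homeomorphic_map (top_of_set X) (subtopology M (chi T s ` X)) (chi T s)"
    using assms(2) by (simp add: subtopology_subtopology inf.absorb2 image_mono)
  then obtain g where g: "homeomorphic_maps (top_of_set X) (subtopology M (chi T s ` X)) (chi T s) g"
    using homeomorphic_map_maps by blast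
  then have "homeomorphic_map (subtopology M (chi T s ` X)) (top_of_set X) g"
    using homeomorphic_maps_map by blast
  moreover have "g (chi T s w) = w" if "w \<in> X" for w
    using g that by (auto simp: homeomorphic_maps_def)
  ultimately show ?thesis using that by blast
qed

section \<open>Purity, and triangles in only one tetrahedron\<close>

text \<open>
  A cell that is no proper face has an open cell that is open in \<open>M\<close>. Its barycentric
  coordinates would be a continuous injection of an open set of \<open>\<real>\<^sup>3\<close> into a plane if there
  were at most three of them.
\<close>

lemma maximal_cell_card:
  assumes s: "s \<in> cells T" and max: "\<And>t. is_face T s t \<Longrightarrow> t = s"
  shows "card (verts T s) \<ge> 4"
proof (rule ccontr)
  assume "\<not> card (verts T s) \<ge> 4"
  then obtain A B C where ABC: "verts T s \<subseteq> {A, B, C}"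
    using subset_three_points[of "verts T s"] finite_verts[OF s] verts_nonempty[OF s] by auto
  define X where "X = open_simplex_on (verts T s)"
  define G where "G = chi T s ` X"
  have "{t. is_face T s t} = {s}" using max face_refl[OF s] by auto
  then have oG: "openin M G" using openin_star[of s] by (simp add: G_def X_def)
  have XS: "X \<subseteq> simplex_on (verts T s)" using open_simplex_subset X_def by auto
  obtain g where g: "homeomorphic_map (subtopology M G) (top_of_set X) g"
      "\<And>w. w \<in> X \<Longrightarrow> g (chi T s w) = w"
    using cell_coordinates[OF s XS] G_def by metis
  define \<phi> :: "('v \<Rightarrow> real) \<Rightarrow> real ^ 3"
    where "\<phi> w = (\<chi> i. if i = 1 then w A else if i = 2 then w B else 0)" for w
  have c\<phi>: "continuous_on X \<phi>"
    unfolding \<phi>_def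
  proof (rule continuous_on_vec_lambda)
    have c: "continuous_on X (\<lambda>w. w v)" for v :: 'v
      by (rule continuous_on_subset[OF continuous_on_product_coordinates]) simp
    show "continuous_on X (\<lambda>w. if i = 1 then w A else if i = 2 then w B else 0)" for i :: 3
      by (cases "i = 1"; cases "i = 2") (simp_all add: c)
  qed
  \<comment> \<open>The third coordinate of \<open>\<phi>\<close> is constantly zero; the weight of \<open>C\<close> is determined by those of \<open>A\<close> and \<open>B\<close>.\<close>
  have i\<phi>: "inj_on \<phi> X"
  proof (rule inj_onI)
    fix w w' assume w: "w \<in> X" "w' \<in> X" "\<phi> w = \<phi> w'"
    have "\<phi> w $ 1 = \<phi> w' $ 1" "\<phi> w $ 2 = \<phi> w' $ 2" using w by simp_all
    then have "w A = w' A" "w B = w' B" by (simp_all add: \<phi>_def)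
    then show "w = w'"
      using simplex_on_eqI[OF finite_verts[OF s], of w w' C] w XS ABC by auto
  qed
  obtain q0 where q0: "q0 \<in> G"
    using open_simplex_on_nonempty finite_verts[OF s] verts_nonempty[OF s] G_def X_def by blast
  obtain U h where U: "q0 \<in> U" "bchart M U h"
    using manifold q0 openin_subset[OF oG] unfolding manifold3_def by blast
  define G' where "G' = G \<inter> U"
  have oG': "openin M G'" using oG U(2) by (auto simp: G'_def bchart_def)
  have GM: "G \<subseteq> topspace M" using oG openin_subset by auto
  have "openin (top_of_set half_space) (h ` G')"
    using chart_image_open[OF U(2) oG'] G'_def by auto
  then obtain q where q: "q \<in> G'" "h q $ 3 > 0"
    using open_half_space_positive_point[of "h ` G'" "h q0"] q0 U(1) unfolding G'_def by blast
  have "continuous_map (subtopology M G') (top_of_set X) g"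
    using homeomorphic_imp_continuous_map[OF g(1)] continuous_map_from_subtopology_mono[of M G _ g G']
    by (auto simp: G'_def)
  then have "continuous_map (subtopology M G') euclidean (\<phi> \<circ> g)"
    by (rule continuous_map_compose) (use c\<phi> in simp)
  moreover have "inj_on (\<phi> \<circ> g) G'"
  proof (rule inj_onI)
    fix p p' assume p: "p \<in> G'" "p' \<in> G'" "(\<phi> \<circ> g) p = (\<phi> \<circ> g) p'"
    obtain w w' where w: "p = chi T s w" "p' = chi T s w'" "w \<in> X" "w' \<in> X"
      using p by (auto simp: G'_def G_def)
    then have "w = w'" using p i\<phi> g(2) by (auto dest: inj_onD)
    then show "p = p'" using w by simp
  qed
  moreover have h0: "(\<phi> \<circ> g) p $ 3 = 0" for p by (simp add: \<phi>_def)
  moreover have "(\<phi> \<circ> g) ` G' \<subseteq> half_space" using h0 unfolding half_space_def by (smt (verit) image_subsetI mem_Collect_eq)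
  ultimately show False
    using chart_positive_height[OF U(2) oG' _ _ _ _ q] by (fastforce simp: G'_def)
qed

text \<open>
  Among the cells that have \<open>e\<close> as a face, one with the most vertices is no proper face.
\<close>

lemma face_of_large_cell:
  assumes "e \<in> cells T"
  shows "\<exists>t. is_face T e t \<and> card (verts T t) \<ge> 4"
proof -
  let ?F = "{t. is_face T e t}"
  have fin: "finite ?F" using finite_cells by (rule rev_finite_subset) (auto simp: is_face_def)
  have "?F \<noteq> {}" using face_refl[OF assms] by blast
  then have "Max ((\<lambda>t. card (verts T t)) ` ?F) \<in> (\<lambda>t. card (verts T t)) ` ?F"
    using fin by (intro Max_in) auto
  then obtain s where s: "is_face T e s" "card (verts T s) = Max ((\<lambda>t. card (verts T t)) ` ?F)"
    by auto
  have s_max: "card (verts T t) \<le> card (verts T s)" if "is_face T e t" for t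
    unfolding s(2) using fin that by (intro Max_ge) auto
  have "t = s" if t: "is_face T s t" for t
  proof -
    have "card (verts T t) \<le> card (verts T s)" using s(1) s_max face_trans t by blast
    then have "verts T s = verts T t"
      using face_verts[OF t] finite_verts[OF face_cells(2)[OF t]] by (metis card_seteq)
    then show ?thesis using face_unique[OF t face_refl] t face_cells by metis
  qed
  then show ?thesis using maximal_cell_card[of s] s face_cells by blast
qed

lemma edge_in_tetrahedron:
  assumes "e \<in> edges T"
  shows "\<exists>t \<in> tetrahedra T. is_face T e t"
proof -
  have e: "e \<in> cells T" "card (verts T e) = 2" using assms by (auto simp: edges_def)
  obtain u where u: "is_face T e u" "card (verts T u) \<ge> 4" using face_of_large_cell e by blast
  obtain S where S: "verts T e \<subseteq> S" "S \<subseteq> verts T u" "card S = 4"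
    using exists_subset_between[of "verts T e" 4 "verts T u"] e u face_verts[OF u(1)]
      finite_verts[OF face_cells(2)[OF u(1)]] by auto
  then obtain t where t: "is_face T t u" "verts T t = S"
    using face_exists[OF face_cells(2)[OF u(1)], of S] by force
  then show ?thesis using face_of_common[OF u(1) t(1)] S face_cells(1)[OF t(1)] by (auto simp: tetrahedra_def)
qed

text \<open>
  A cell with more than four vertices would contain the triangle in several tetrahedra, one for each
  of its further vertices.
\<close>

lemma cofaces_of_free_triangle:
  assumes f: "f \<in> cells T" "card (verts T f) = 3" and t: "t \<in> tetrahedra T" "is_face T f t"
    and uniq: "\<And>t'. t' \<in> tetrahedra T \<Longrightarrow> is_face T f t' \<Longrightarrow> t' = t"
    and r: "is_face T f r"
  shows "r = f \<or> r = t"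
proof (cases "verts T r = verts T f")
  case True
  then show ?thesis using face_unique[OF r face_refl] r face_cells by metis
next
  case False
  have fin: "finite (verts T r)" using r face_cells finite_verts by blast
  have tet: "verts T t = insert d (verts T f)" if d: "d \<in> verts T r - verts T f" for d
  proof -
    obtain s where s: "is_face T s r" "verts T s = insert d (verts T f)"
      using face_exists[of r "insert d (verts T f)"] d face_verts[OF r] face_cells[OF r] by auto
    have "card (verts T s) = 4" using s d f finite_verts by simp
    then have "s \<in> tetrahedra T" using face_cells(1)[OF s(1)] by (simp add: tetrahedra_def)
    moreover have "is_face T f s" using face_of_common[OF r s(1)] s(2) by auto
    ultimately show ?thesis using uniq s by blast
  qed
  obtain d where d: "d \<in> verts T r - verts T f" using False face_verts[OF r] by blast
  have "verts T r \<subseteq> insert d (verts T f)" using tet[OF d] tet d by blast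
  then have "verts T r = insert d (verts T f)" using d face_verts[OF r] by blast
  then have "card (verts T r) = 4" using d f finite_verts by simp
  then show ?thesis using uniq r face_cells by (auto simp: tetrahedra_def)
qed

text \<open>
  Around an interior point of a triangle that lies in only one tetrahedron, \<open>M\<close> looks like
  that tetrahedron without its other faces; barycentric coordinates form a chart there that
  sends the triangle to the plane bounding the half-space.
\<close>

lemma free_triangle_open_cell_in_bdry:
  assumes f: "f \<in> cells T" "card (verts T f) = 3" and t: "t \<in> tetrahedra T" "is_face T f t"
    and uniq: "\<And>t'. t' \<in> tetrahedra T \<Longrightarrow> is_face T f t' \<Longrightarrow> t' = t"
  shows "chi T f ` open_simplex_on (verts T f) \<subseteq> bdry M"
proof -
  obtain A B C where f3: "verts T f = {A, B, C}" "distinct [A, B, C]"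
    using f by (auto simp: card_3_iff)
  have tc: "t \<in> cells T" "card (verts T t) = 4" using t by (auto simp: tetrahedra_def)
  then have "card (verts T t - verts T f) = 1"
    using face_verts[OF t(2)] f finite_verts by (subst card_Diff_subset) auto
  then obtain D where "verts T t - verts T f = {D}" by (auto simp: card_1_singleton_iff)
  then have t4: "verts T t = {A, B, C, D}" "distinct [A, B, C, D]"
    using face_verts[OF t(2)] f3 by auto
  define X where "X = {w \<in> simplex_on (verts T t). w A > 0 \<and> w B > 0 \<and> w C > 0}"
  define U where "U = chi T t ` X"
  \<comment> \<open>The open star of the triangle consists of the open triangle and the open tetrahedron.\<close>
  have "U = (\<Union>s \<in> {s. is_face T f s}. chi T s ` open_simplex_on (verts T s))" (is "_ = ?S")
  proof
    show "U \<subseteq> ?S"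
    proof
      fix p assume "p \<in> U"
      then obtain w where w: "w \<in> X" "p = chi T t w" by (auto simp: U_def)
      then obtain r where r: "is_face T r t" "verts T r = {v. w v > 0}"
          "w \<in> open_simplex_on (verts T r)" "chi T r w = chi T t w"
        using carrier_face[OF tc(1), of w] by (auto simp: X_def)
      have "is_face T f r" using face_of_common[OF t(2) r(1)] r(2) w f3 by (auto simp: X_def)
      then show "p \<in> ?S" using r w by force
    qed
    show "?S \<subseteq> U"
    proof
      fix p assume "p \<in> ?S"
      then obtain s w where s: "is_face T f s" "w \<in> open_simplex_on (verts T s)" "p = chi T s w"
        by blast
      have "is_face T s t" using cofaces_of_free_triangle[OF f t uniq s(1)] t face_refl[OF tc(1)] by blast
      moreover have "w A > 0" "w B > 0" "w C > 0"
        using s(2) face_verts[OF s(1)] f3 by (auto simp: open_simplex_on_def)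
      ultimately show "p \<in> U" using s open_simplex_subset face_simplex face_chi
        unfolding U_def X_def by blast
    qed
  qed
  then have oU: "openin M U" using openin_star[of f] by simp
  have XS: "X \<subseteq> simplex_on (verts T t)" by (auto simp: X_def)
  obtain g where g: "homeomorphic_map (subtopology M U) (top_of_set X) g"
      "\<And>w. w \<in> X \<Longrightarrow> g (chi T t w) = w"
    using cell_coordinates[OF tc(1) XS] U_def by metis
  define \<phi> :: "('v \<Rightarrow> real) \<Rightarrow> real ^ 3"
    where "\<phi> w = (\<chi> i. if i = 1 then w A else if i = 2 then w B else w D)" for w
  define \<kappa> :: "real ^ 3 \<Rightarrow> 'v \<Rightarrow> real"
    where "\<kappa> y = (\<lambda>v. if v = A then y $ 1 else if v = B then y $ 2 else if v = D then y $ 3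
        else if v = C then 1 - y $ 1 - y $ 2 - y $ 3 else 0)" for y
  define Y where "Y = {y :: real ^ 3. y $ 1 > 0 \<and> y $ 2 > 0 \<and> y $ 1 + y $ 2 + y $ 3 < 1} \<inter> half_space"
  have sum1: "w \<in> simplex_on (verts T t) \<Longrightarrow> w A + w B + w C + w D = 1" for w
    using t4 by (simp add: simplex_on_def)
  have \<phi>Y: "\<phi> w \<in> Y" if w: "w \<in> X" for w
    using w sum1[of w] t4 by (auto simp: X_def \<phi>_def Y_def half_space_def simplex_on_def)
  have \<kappa>X: "\<kappa> y \<in> X" if "y \<in> Y" for y
    using that t4 by (auto simp: X_def \<kappa>_def Y_def half_space_def simplex_on_def)
  have \<phi>\<kappa>: "\<phi> (\<kappa> y) = y" for y
    using t4 by (auto simp: \<phi>_def \<kappa>_def vec_eq_iff) (metis exhaust_3)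
  have \<kappa>\<phi>: "\<kappa> (\<phi> w) = w" if w: "w \<in> X" for w
  proof (rule simplex_on_eqI[of "verts T t" _ _ C])
    show "\<kappa> (\<phi> w) \<in> simplex_on (verts T t)" "w \<in> simplex_on (verts T t)"
      using \<kappa>X[OF \<phi>Y[OF w]] w by (auto simp: X_def)
    show "\<kappa> (\<phi> w) v = w v" if "v \<in> verts T t - {C}" for v
      using that t4 by (auto simp: \<kappa>_def \<phi>_def)
  qed (use t4 in simp)
  have img: "\<phi> ` X = Y" using \<phi>Y \<kappa>X \<phi>\<kappa> by (metis image_subset_iff imageI subsetI subset_antisym)
  have "homeomorphic_maps (top_of_set X) (top_of_set Y) \<phi> \<kappa>"
    unfolding homeomorphic_maps_def continuous_map_in_subtopology
  proof (intro conjI)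
    have "continuous_on X \<phi>"
      unfolding \<phi>_def
    proof (rule continuous_on_vec_lambda)
      have c: "continuous_on X (\<lambda>w. w v)" for v :: 'v
        by (rule continuous_on_subset[OF continuous_on_product_coordinates]) simp
      show "continuous_on X (\<lambda>w. if i = 1 then w A else if i = 2 then w B else w D)" for i :: 3
        by (cases "i = 1"; cases "i = 2") (simp_all add: c)
    qed
    then show "continuous_map (top_of_set X) euclidean \<phi>" by simp
    have "continuous_on Y \<kappa>"
      unfolding \<kappa>_def
    proof (rule continuous_on_coordinatewise_then_product)
      have c: "continuous_on Y (\<lambda>y. y $ i)" "continuous_on Y (\<lambda>y. 1 - y $ 1 - y $ 2 - y $ 3)" for i
        by (intro continuous_intros)+
      show "continuous_on Y (\<lambda>y. if v = A then y $ 1 else if v = B then y $ 2 else if v = D then y $ 3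
          else if v = C then 1 - y $ 1 - y $ 2 - y $ 3 else 0)" for v
        by (cases "v = A"; cases "v = B"; cases "v = C"; cases "v = D") (simp_all add: c)
    qed
    then show "continuous_map (top_of_set Y) euclidean \<kappa>" by simp
  qed (use \<phi>Y \<kappa>X \<phi>\<kappa> \<kappa>\<phi> in auto)
  then have "homeomorphic_map (top_of_set X) (top_of_set Y) \<phi>" using homeomorphic_map_maps by blast
  then have hm: "homeomorphic_map (subtopology M U) (top_of_set Y) (\<phi> \<circ> g)"
    by (rule homeomorphic_map_compose[OF g(1)])
  have im: "(\<phi> \<circ> g) ` U = Y" using g(2) img by (force simp: U_def image_image)
  have "open {y :: real ^ 3. y $ 1 > 0 \<and> y $ 2 > 0 \<and> y $ 1 + y $ 2 + y $ 3 < 1}"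
    by (intro open_Collect_conj open_Collect_less continuous_intros)
  then have "openin (top_of_set half_space) Y" unfolding Y_def by (auto simp: openin_open)
  then have ch: "bchart M U (\<phi> \<circ> g)" unfolding bchart_def im using oU hm by blast
  show ?thesis
  proof
    fix p assume "p \<in> chi T f ` open_simplex_on (verts T f)"
    then obtain w where w: "w \<in> open_simplex_on (verts T f)" "p = chi T f w" by blast
    then have ws: "w \<in> simplex_on (verts T f)" using open_simplex_subset by blast
    have "w D = 0" using ws f3 t4 by (auto simp: simplex_on_def)
    have "w \<in> X" using w(1) f3 face_simplex[OF t(2)] ws by (auto simp: X_def open_simplex_on_def)
    moreover have "p = chi T t w" using w face_chi[OF t(2) ws] by simp
    ultimately have "p \<in> U" "(\<phi> \<circ> g) p $ 3 = 0" using g(2) \<open>w D = 0\<close> by (auto simp: U_def \<phi>_def)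
    then show "p \<in> bdry M" using ch openin_subset[OF oU] unfolding bdry_def by blast
  qed
qed

text \<open>
  Points of the open cell, on a segment to an inner point of it, approach any given point of the closed cell.
\<close>

lemma cell_in_bdry_if_open_cell:
  assumes s: "s \<in> cells T" and sub: "chi T s ` open_simplex_on (verts T s) \<subseteq> bdry M"
  shows "cell_set T s \<subseteq> bdry M"
proof (rule ccontr)
  assume "\<not> cell_set T s \<subseteq> bdry M"
  then obtain w where w: "w \<in> simplex_on (verts T s)" "chi T s w \<notin> bdry M" by (auto simp: cell_set_def)
  obtain b where b: "b \<in> open_simplex_on (verts T s)"
    using open_simplex_on_nonempty finite_verts[OF s] verts_nonempty[OF s] by blast
  have "openin (top_of_set (simplex_on (verts T s)))
      {v \<in> topspace (top_of_set (simplex_on (verts T s))). chi T s v \<in> topspace M - bdry M}"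
    using chi_continuous[OF s] openin_interior_points[OF manifold] by (rule openin_continuous_map_preimage)
  then obtain O' where O': "open O'"
      "{v \<in> simplex_on (verts T s). chi T s v \<in> topspace M - bdry M} = simplex_on (verts T s) \<inter> O'"
    by (auto simp: openin_open)
  have "w \<in> O'" using w O' chi_in_topspace[OF s w(1)] by blast
  moreover have "segment_to w b 0 = w" by (simp add: segment_to_def)
  moreover have "open (segment_to w b -` O')"
    using O'(1) segment_to_continuous[of UNIV w b] by (simp add: continuous_on_open_vimage)
  ultimately obtain e where e: "e > 0" "ball 0 e \<subseteq> segment_to w b -` O'"
    by (metis open_contains_ball vimageI)
  define r where "r = min 1 (e/2)"
  have r: "0 < r" "r \<le> 1" "r \<in> ball 0 e" using e(1) by (auto simp: r_def)
  have "segment_to w b r \<in> simplex_on (verts T s)"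
    using segment_to_in_simplex[OF w(1), of b r] subsetD[OF open_simplex_subset b] r by simp
  moreover have "0 < segment_to w b r v" if "v \<in> verts T s" for v
    using that w(1) b r by (auto simp: segment_to_def simplex_on_def open_simplex_on_def intro!: add_nonneg_pos)
  ultimately have "segment_to w b r \<in> open_simplex_on (verts T s)" by (simp add: open_simplex_on_def)
  moreover from this have "chi T s (segment_to w b r) \<notin> bdry M"
    using O'(2) e(2) r open_simplex_subset by blast
  ultimately show False using sub by blast
qed

lemma free_triangle_in_bdry:
  assumes "f \<in> cells T" "card (verts T f) = 3" "t \<in> tetrahedra T" "is_face T f t"
    and "\<And>t'. t' \<in> tetrahedra T \<Longrightarrow> is_face T f t' \<Longrightarrow> t' = t"
  shows "cell_set T f \<subseteq> bdry M"
  using cell_in_bdry_if_open_cell free_triangle_open_cell_in_bdry assms by metis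

section \<open>Vertices on boundary components\<close>

lemma cell_set_nonempty: "s \<in> cells T \<Longrightarrow> cell_set T s \<noteq> {}"
  unfolding cell_set_def using open_simplex_on_nonempty[OF finite_verts verts_nonempty] open_simplex_subset
  by fastforce

lemma vertex_in_if_cell:
  assumes "s \<in> cells T" "A \<in> verts T s" "cell_set T s \<subseteq> X"
  shows "vertex_in T A X"
proof -
  obtain a where "is_face T a s" "verts T a = {A}" using face_exists[OF assms(1), of "{A}"] assms by auto
  then show ?thesis using face_cell_set[of a s] face_cells(1) assms unfolding vertex_in_def by blast
qed

lemma cell_in_bdry_component:
  assumes s: "s \<in> cells T" and b: "cell_set T s \<subseteq> bdry M"
  shows "\<exists>c \<in> bdry_components M. cell_set T s \<subseteq> c"
proof -
  have "connectedin M (cell_set T s)"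
    unfolding cell_set_def
    by (rule connectedin_continuous_map_image[OF chi_continuous[OF s]])
       (simp add: connectedin_subtopology connected_simplex_on)
  then have "connectedin (subtopology M (bdry M)) (cell_set T s)"
    using b by (simp add: connectedin_subtopology)
  moreover from this have "subtopology M (bdry M) \<noteq> trivial_topology"
    using cell_set_nonempty[OF s] connectedin_subset_topspace by fastforce
  ultimately show ?thesis
    unfolding bdry_components_def using exists_connected_component_of_superset by blast
qed

lemma vertex_component_unique:
  assumes "c \<in> bdry_components M" "c' \<in> bdry_components M" "vertex_in T A c" "vertex_in T A c'"
  shows "c = c'"
proof -
  obtain s s' where s: "s \<in> cells T" "verts T s = {A}" "cell_set T s \<subseteq> c"
    "s' \<in> cells T" "verts T s' = {A}" "cell_set T s' \<subseteq> c'"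
    using assms by (auto simp: vertex_in_def)
  then have "s = s'" using vertex_cell_unique by blast
  then have "\<not> disjnt c c'" using s cell_set_nonempty by (fastforce simp: disjnt_def)
  then show ?thesis
    using connected_components_of_disjoint assms(1,2) unfolding bdry_components_def by blast
qed

lemma component_subset_bdry: "c \<in> bdry_components M \<Longrightarrow> c \<subseteq> bdry M"
  unfolding bdry_components_def using connected_components_of_subset by fastforce

lemma inner_vertex_not_in_component:
  "A \<in> inner_vertices T M \<Longrightarrow> c \<in> bdry_components M \<Longrightarrow> \<not> vertex_in T A c"
  using component_subset_bdry unfolding inner_vertices_def vertex_in_def by blast

lemma outer_vertex_in_component:
  assumes "A \<in> vertices T" "A \<notin> inner_vertices T M"
  shows "\<exists>c \<in> bdry_components M. vertex_in T A c"
proof -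
  obtain s where s: "s \<in> cells T" "verts T s = {A}" "cell_set T s \<subseteq> bdry M"
    using assms by (auto simp: inner_vertices_def vertex_in_def)
  then obtain c where "c \<in> bdry_components M" "cell_set T s \<subseteq> c" using cell_in_bdry_component by blast
  then show ?thesis using s unfolding vertex_in_def by blast
qed

lemma finite_vertices: "finite (vertices T)"
  unfolding vertices_def using finite_cells finite_verts by blast

lemma finite_inner_vertices: "finite (inner_vertices T M)"
  using finite_vertices by (rule rev_finite_subset) (auto simp: inner_vertices_def)

end

unbundle cross3_syntax

section \<open>Dihedral angles as functions of squared edge lengths\<close>

text \<open>
  For a tetrahedron \<open>abcd\<close> the six variables \<open>p, q, r, s, t, k\<close> stand for the squares of the lengths of
  \<open>ab, ac, ad, bc, bd, cd\<close>. In terms of the edge vectors \<open>u = b - a\<close>, \<open>v = c - a\<close>, \<open>w = d - a\<close> one has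
  \<open>u \<bullet> v = (p + q - s) / 2\<close> and so on. Then \<open>face_gram\<close> and \<open>tet_gram\<close> are the Gram determinants of
  \<open>u, v\<close> and of \<open>u, v, w\<close>, and \<open>dihedral_num\<close> is the inner product of the components of \<open>v\<close> and
  \<open>w\<close> perpendicular to \<open>u\<close>, multiplied by \<open>p\<close>.
\<close>

definition dihedral_num :: "real \<Rightarrow> real \<Rightarrow> real \<Rightarrow> real \<Rightarrow> real \<Rightarrow> real \<Rightarrow> real" where
  "dihedral_num p q r s t k = p * (q + r - k) / 2 - (p + q - s) * (p + r - t) / 4"

definition face_gram :: "real \<Rightarrow> real \<Rightarrow> real \<Rightarrow> real" where
  "face_gram p q s = p * q - (p + q - s)\<^sup>2 / 4"

definition tet_gram :: "real \<Rightarrow> real \<Rightarrow> real \<Rightarrow> real \<Rightarrow> real \<Rightarrow> real \<Rightarrow> real" where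
  "tet_gram p q r s t k = p * q * r + (p + q - s) * (p + r - t) * (q + r - k) / 4
     - p * (q + r - k)\<^sup>2 / 4 - q * (p + r - t)\<^sup>2 / 4 - r * (p + q - s)\<^sup>2 / 4"

definition dihedral_sq :: "real \<Rightarrow> real \<Rightarrow> real \<Rightarrow> real \<Rightarrow> real \<Rightarrow> real \<Rightarrow> real" where
  "dihedral_sq p q r s t k =
     arccos (dihedral_num p q r s t k / (sqrt (face_gram p q s) * sqrt (face_gram p r t)))"

text \<open>
  A dihedral angle does not depend on the order of the ends of the edge nor on the order of
  the two faces.
\<close>

lemma dihedral_sq_swap_ends: "dihedral_sq p q r s t k = dihedral_sq p s t q r k"
proof -
  have "dihedral_num p q r s t k = dihedral_num p s t q r k"
    "face_gram p q s = face_gram p s q" "face_gram p r t = face_gram p t r"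
    unfolding dihedral_num_def face_gram_def by (simp_all add: field_simps power2_eq_square)
  then show ?thesis by (simp add: dihedral_sq_def)
qed

lemma dihedral_sq_swap_faces: "dihedral_sq p q r s t k = dihedral_sq p r q t s k"
  by (simp add: dihedral_sq_def dihedral_num_def mult.commute add.commute)

text \<open>
  This is Jacobi's identity for the minors of the Gram matrix of \<open>u, v, w\<close>. Divided by \<open>p\<^sup>2\<close>,
  the left-hand side is the squared area of the parallelogram spanned by the components of \<open>v\<close> and
  \<open>w\<close> perpendicular to \<open>u\<close>; so the derivative of \<open>arccos\<close> has the square root of
  \<open>p * tet_gram p q r s t k\<close> in its denominator.
\<close>

lemma face_gram_mult:
  "face_gram p q s * face_gram p r t - (dihedral_num p q r s t k)\<^sup>2 = p * tet_gram p q r s t k"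
  unfolding face_gram_def dihedral_num_def tet_gram_def by (simp add: field_simps power2_eq_square)

lemma inner_from_dist:
  fixes a b c :: "'a::real_inner"
  shows "(b - a) \<bullet> (c - a) = ((dist a b)\<^sup>2 + (dist a c)\<^sup>2 - (dist b c)\<^sup>2) / 2"
  by (simp add: dist_norm power2_norm_eq_inner inner_diff inner_commute algebra_simps)

lemma inner_perp_part:
  assumes "u \<noteq> 0"
  shows "perp_part u v \<bullet> perp_part u w = v \<bullet> w - (v \<bullet> u) * (w \<bullet> u) / (u \<bullet> u)"
  using assms by (simp add: perp_part_def inner_diff inner_commute field_simps power2_eq_square)

lemma perp_part_orthogonal: "u \<bullet> perp_part u v = 0"
  by (cases "u = 0") (simp_all add: perp_part_def inner_diff inner_commute)

lemma dihedral_angle_eq_dihedral_sq: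
  assumes "a \<noteq> b"
  shows "dihedral_angle a b c d = dihedral_sq ((dist a b)\<^sup>2) ((dist a c)\<^sup>2) ((dist a d)\<^sup>2)
    ((dist b c)\<^sup>2) ((dist b d)\<^sup>2) ((dist c d)\<^sup>2)" (is "_ = dihedral_sq ?p ?q ?r ?s ?t ?k")
proof -
  define u v w where uvw: "u = b - a" "v = c - a" "w = d - a"
  have u: "u \<noteq> 0" "u \<bullet> u = ?p" "?p > 0"
    using assms uvw inner_from_dist[where a=a and b=b and c=b] by (simp_all)
  have vv: "v \<bullet> v = ?q" "w \<bullet> w = ?r" "v \<bullet> u = (?p + ?q - ?s) / 2" "w \<bullet> u = (?p + ?r - ?t) / 2"
    "v \<bullet> w = (?q + ?r - ?k) / 2"
    unfolding uvw by (subst inner_from_dist; simp add: dist_commute)+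
  have Gram: "y - ((p + y - x) / 2) * ((p + y - x) / 2) / p = face_gram p y x / p" if "p > 0" for p x y
    using that by (simp add: face_gram_def field_simps power2_eq_square)
  have P: "perp_part u v \<bullet> perp_part u w = dihedral_num ?p ?q ?r ?s ?t ?k / ?p"
    using u unfolding inner_perp_part[OF u(1)] vv u(2) dihedral_num_def
    by (simp add: field_simps)
  have Q: "norm (perp_part u v) = sqrt (face_gram ?p ?q ?s / ?p)"
    unfolding norm_eq_sqrt_inner inner_perp_part[OF u(1)] vv u(2) Gram[OF u(3)] ..
  have R: "norm (perp_part u w) = sqrt (face_gram ?p ?r ?t / ?p)"
    unfolding norm_eq_sqrt_inner inner_perp_part[OF u(1)] vv u(2) Gram[OF u(3)] ..
  have cancel: "(x / p) / (y / p) = x / y" if "p > 0" for p x y :: real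
    using that by simp
  have prod: "norm (perp_part u v) * norm (perp_part u w) =
      sqrt (face_gram ?p ?q ?s) * sqrt (face_gram ?p ?r ?t) / ?p"
    unfolding Q R real_sqrt_divide by (simp add: power2_eq_square)
  show ?thesis
    unfolding dihedral_angle_def dihedral_sq_def Let_def P uvw[symmetric] prod cancel[OF u(3)] ..
qed

text \<open>
  The Cholesky factor of the Gram matrix: \<open>a\<close> is the origin, \<open>b\<close> lies on the first axis
  and \<open>c\<close> in the plane of the first two axes.
\<close>

lemma tetrahedron_realization:
  assumes p: "p > 0" and Q: "face_gram p q s > 0" and G: "tet_gram p q r s t k > 0"
  obtains a b c d :: "real ^ 3" where
    "(dist a b)\<^sup>2 = p" "(dist a c)\<^sup>2 = q" "(dist a d)\<^sup>2 = r"
    "(dist b c)\<^sup>2 = s" "(dist b d)\<^sup>2 = t" "(dist c d)\<^sup>2 = k"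
proof -
  define P g12 g13 where Pg: "P = dihedral_num p q r s t k" "g12 = (p + q - s) / 2" "g13 = (p + r - t) / 2"
  define \<alpha> \<beta> \<gamma> where sq: "\<alpha> = sqrt p" "\<beta> = sqrt (face_gram p q s)" "\<gamma> = sqrt (tet_gram p q r s t k)"
  have pos: "\<alpha> > 0" "\<beta> > 0" "\<gamma> > 0" using assms by (auto simp: sq)
  have sq2: "\<alpha>\<^sup>2 = p" "\<beta>\<^sup>2 = face_gram p q s" "\<gamma>\<^sup>2 = tet_gram p q r s t k"
    using assms by (auto simp: sq)
  define b c d :: "real ^ 3" where bcd: "b = vector [\<alpha>, 0, 0]" "c = vector [g12 / \<alpha>, \<beta> / \<alpha>, 0]"
    "d = vector [g13 / \<alpha>, P / (\<alpha> * \<beta>), \<gamma> / \<beta>]"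
  have bb: "b \<bullet> b = p" using sq2 by (simp add: bcd inner_vec_def sum_3 flip: power2_eq_square)
  have bc: "b \<bullet> c = g12" "b \<bullet> d = g13" using pos by (simp_all add: bcd inner_vec_def sum_3)
  have "c \<bullet> c = (g12\<^sup>2 + \<beta>\<^sup>2) / \<alpha>\<^sup>2" using pos
    by (simp add: bcd inner_vec_def sum_3 field_simps power2_eq_square)
  also have "\<dots> = q" using p unfolding sq2 by (simp add: Pg face_gram_def field_simps power2_eq_square)
  finally have cc: "c \<bullet> c = q" .
  have "c \<bullet> d = (g12 * g13 + P) / \<alpha>\<^sup>2" using pos
    by (simp add: bcd inner_vec_def sum_3 field_simps power2_eq_square)
  also have "\<dots> = (q + r - k) / 2" using p unfolding sq2 by (simp add: Pg dihedral_num_def field_simps)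
  finally have cd: "c \<bullet> d = (q + r - k) / 2" .
  have "d \<bullet> d = (g13\<^sup>2 * \<beta>\<^sup>2 + (P\<^sup>2 + \<alpha>\<^sup>2 * \<gamma>\<^sup>2)) / (\<alpha>\<^sup>2 * \<beta>\<^sup>2)" using pos
    by (simp add: bcd inner_vec_def sum_3 field_simps power2_eq_square)
  also have "P\<^sup>2 + \<alpha>\<^sup>2 * \<gamma>\<^sup>2 = face_gram p q s * face_gram p r t"
    unfolding sq2 Pg using face_gram_mult[of p q s r t k] by simp
  also have "(g13\<^sup>2 * \<beta>\<^sup>2 + face_gram p q s * face_gram p r t) / (\<alpha>\<^sup>2 * \<beta>\<^sup>2) = (g13\<^sup>2 + face_gram p r t) / p"
    unfolding sq2 using p Q by (simp add: field_simps)
  also have "\<dots> = r" using p by (simp add: Pg face_gram_def field_simps power2_eq_square)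
  finally have dd: "d \<bullet> d = r" .
  have dist2: "(dist y z)\<^sup>2 = y \<bullet> y + z \<bullet> z - 2 * (y \<bullet> z)" for y z :: "real ^ 3"
    by (simp add: dist_norm power2_norm_eq_inner inner_diff inner_commute algebra_simps)
  show ?thesis
    by (rule that[of 0 b c d]; unfold dist2 bb bc cc cd dd Pg(2,3)) (simp_all add: field_simps)
qed

lemma face_gram_eq_cross:
  "face_gram ((dist a b)\<^sup>2) ((dist a c)\<^sup>2) ((dist b c)\<^sup>2) = (norm ((b - a) \<times> (c - a)))\<^sup>2"
  using norm_cross_dot[of "b - a" "c - a"]
  unfolding inner_from_dist face_gram_def
  by (simp add: dist_norm norm_minus_commute power_mult_distrib power_divide)

lemma tet_gram_eq_det:
  fixes a b c d :: "real ^ 3"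
  shows "tet_gram ((dist a b)\<^sup>2) ((dist a c)\<^sup>2) ((dist a d)\<^sup>2) ((dist b c)\<^sup>2) ((dist b d)\<^sup>2) ((dist c d)\<^sup>2)
    = (det (vector [b - a, c - a, d - a] :: real ^ 3 ^ 3))\<^sup>2"
proof -
  have gram: "(u \<bullet> u) * (v \<bullet> v) * (w \<bullet> w) + 2 * (u \<bullet> v) * (u \<bullet> w) * (v \<bullet> w)
      - (u \<bullet> u) * (v \<bullet> w)\<^sup>2 - (v \<bullet> v) * (u \<bullet> w)\<^sup>2 - (w \<bullet> w) * (u \<bullet> v)\<^sup>2
    = (det (vector [u, v, w] :: real ^ 3 ^ 3))\<^sup>2" for u v w :: "real ^ 3"
    by (simp add: det_3 inner_vec_def sum_3 power2_eq_square algebra_simps)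
  show ?thesis
    unfolding gram[symmetric] inner_from_dist tet_gram_def
    by (simp add: field_simps power2_eq_square)
qed

subsection \<open>Derivatives with respect to the squared lengths\<close>

lemma DERIV_arccos_quotient:
  fixes P Q R :: "real \<Rightarrow> real"
  assumes "(P has_real_derivative P') (at z)" "(Q has_real_derivative Q') (at z)"
    "(R has_real_derivative R') (at z)" and pos: "Q z > 0" "R z > 0" "Q z * R z - (P z)\<^sup>2 > 0"
  shows "((\<lambda>z. arccos (P z / (sqrt (Q z) * sqrt (R z)))) has_real_derivative
    - (P' - P z / 2 * (Q' / Q z + R' / R z)) / sqrt (Q z * R z - (P z)\<^sup>2)) (at z)"
proof -
  define N where "N = sqrt (Q z) * sqrt (R z)"
  have N: "N > 0" "N\<^sup>2 = Q z * R z" using pos by (auto simp: N_def power_mult_distrib)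
  have "(P z)\<^sup>2 < N\<^sup>2" using pos N by simp
  then have "\<bar>P z\<bar> < N" using N(1) by (metis abs_le_square_iff abs_of_pos linorder_not_less)
  then have lt: "-1 < P z / N" "P z / N < 1" using N by (auto simp: field_simps)
  have d: "((\<lambda>z. P z / (sqrt (Q z) * sqrt (R z))) has_real_derivative
      (P' - P z / 2 * (Q' / Q z + R' / R z)) / N) (at z)"
  proof -
    have raw: "((\<lambda>z. P z / (sqrt (Q z) * sqrt (R z))) has_real_derivative
      (P' * N - P z * (Q' * (inverse (sqrt (Q z)) / 2) * sqrt (R z) + R' * (inverse (sqrt (R z)) / 2) * sqrt (Q z))) / (N * N)) (at z)"
      using pos N unfolding N_def
      by (auto intro!: derivative_eq_intros assms simp: algebra_simps)
    have half: "Q' * (inverse (sqrt (Q z)) / 2) * sqrt (R z) = Q' / Q z / 2 * N"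
      "R' * (inverse (sqrt (R z)) / 2) * sqrt (Q z) = R' / R z / 2 * N"
      using pos by (auto simp: N_def field_simps)
    have quot: "(P' * N - P z * (x / 2 * N + y / 2 * N)) / (N * N) = (P' - P z / 2 * (x + y)) / N" for x y
      using N(1) by (simp add: field_simps)
    show ?thesis using raw unfolding half quot .
  qed
  have root: "sqrt (1 - (P z / N)\<^sup>2) = sqrt (Q z * R z - (P z)\<^sup>2) / N"
  proof -
    have "1 - (P z / N)\<^sup>2 = (Q z * R z - (P z)\<^sup>2) / N\<^sup>2"
      using pos by (simp add: N(2) power_divide diff_divide_distrib)
    then show ?thesis using N(1) by (simp add: real_sqrt_divide)
  qed
  have cancel: "inverse (- (S / N)) * (X / N) = - X / S" for S X
    using N(1) by (simp add: divide_inverse)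
  have "((\<lambda>z. arccos (P z / (sqrt (Q z) * sqrt (R z)))) has_real_derivative
      inverse (- sqrt (1 - (P z / N)\<^sup>2)) * ((P' - P z / 2 * (Q' / Q z + R' / R z)) / N)) (at z)"
    using DERIV_chain2[OF DERIV_arccos d] lt unfolding N_def by blast
  then show ?thesis unfolding root cancel .
qed

text \<open>
  The differential of \<open>dihedral_sq\<close>: the primed variables are the changes of the squared lengths.
\<close>

definition dihedral_diff :: "real \<Rightarrow> real \<Rightarrow> real \<Rightarrow> real \<Rightarrow> real \<Rightarrow> real \<Rightarrow>
    real \<Rightarrow> real \<Rightarrow> real \<Rightarrow> real \<Rightarrow> real \<Rightarrow> real \<Rightarrow> real" where
  "dihedral_diff p q r s t k p' q' r' s' t' k' =
    - (p' * (q + r - k) / 2 + p * (q' + r' - k') / 2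
         - ((p' + q' - s') * (p + r - t) + (p + q - s) * (p' + r' - t')) / 4
       - dihedral_num p q r s t k / 2 *
         ((p' * q + p * q' - (p + q - s) * (p' + q' - s') / 2) / face_gram p q s
          + (p' * r + p * r' - (p + r - t) * (p' + r' - t') / 2) / face_gram p r t))
      / sqrt (p * tet_gram p q r s t k)"

lemma dihedral_sq_has_derivative:
  assumes d: "(p has_real_derivative p') (at z)" "(q has_real_derivative q') (at z)"
    "(r has_real_derivative r') (at z)" "(s has_real_derivative s') (at z)"
    "(t has_real_derivative t') (at z)" "(k has_real_derivative k') (at z)"
    and pos: "face_gram (p z) (q z) (s z) > 0" "face_gram (p z) (r z) (t z) > 0" "p z > 0"
      "tet_gram (p z) (q z) (r z) (s z) (t z) (k z) > 0"
  shows "((\<lambda>z. dihedral_sq (p z) (q z) (r z) (s z) (t z) (k z)) has_real_derivative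
    dihedral_diff (p z) (q z) (r z) (s z) (t z) (k z) p' q' r' s' t' k') (at z)"
proof -
  have P: "((\<lambda>z. dihedral_num (p z) (q z) (r z) (s z) (t z) (k z)) has_real_derivative
      p' * (q z + r z - k z) / 2 + p z * (q' + r' - k') / 2
       - ((p' + q' - s') * (p z + r z - t z) + (p z + q z - s z) * (p' + r' - t')) / 4) (at z)"
    unfolding dihedral_num_def by (auto intro!: derivative_eq_intros d simp: field_simps)
  have F: "((\<lambda>z. face_gram (p z) (f z) (g z)) has_real_derivative
      p' * f z + p z * f' - (p z + f z - g z) * (p' + f' - g') / 2) (at z)"
    if "(f has_real_derivative f') (at z)" "(g has_real_derivative g') (at z)" for f g f' g'
    unfolding face_gram_def by (auto intro!: derivative_eq_intros d that simp: field_simps)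
  have "face_gram (p z) (q z) (s z) * face_gram (p z) (r z) (t z)
      - (dihedral_num (p z) (q z) (r z) (s z) (t z) (k z))\<^sup>2 > 0"
    unfolding face_gram_mult using pos by simp
  from DERIV_arccos_quotient[OF P F[OF d(2,4)] F[OF d(3,5)] pos(1,2) this] show ?thesis
    unfolding dihedral_sq_def dihedral_diff_def face_gram_mult .
qed

lemma dihedral_diff_linear:
  "dihedral_diff p q r s t k p' q' r' s' t' k' =
     p' * dihedral_diff p q r s t k 1 0 0 0 0 0 + q' * dihedral_diff p q r s t k 0 1 0 0 0 0
   + r' * dihedral_diff p q r s t k 0 0 1 0 0 0 + s' * dihedral_diff p q r s t k 0 0 0 1 0 0
   + t' * dihedral_diff p q r s t k 0 0 0 0 1 0 + k' * dihedral_diff p q r s t k 0 0 0 0 0 1"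
proof -
  define I J K n where defs: "I = inverse (face_gram p q s)" "J = inverse (face_gram p r t)"
    "K = inverse (sqrt (p * tet_gram p q r s t k))" "n = dihedral_num p q r s t k"
  show ?thesis
    unfolding dihedral_diff_def divide_inverse defs[symmetric]
    by (simp add: algebra_simps add_divide_distrib diff_divide_distrib)
qed

lemma tet_gram_perms:
  "tet_gram p q r s t k = tet_gram q p r s k t" "tet_gram p q r s t k = tet_gram k q s r t p"
  unfolding tet_gram_def by (simp_all add: field_simps power2_eq_square)

text \<open>
  The left-hand side is the derivative of the angle at \<open>ab\<close> with respect to the length \<open>lq\<close> of \<open>ac\<close>, the
  right-hand side that of the angle at \<open>ac\<close> with respect to the length \<open>lp\<close> of \<open>ab\<close>, for the same
  tetrahedron labelled \<open>acbd\<close>. In both cases the only Gram determinant of a face at the edge that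
  changes is that of the common face \<open>abc\<close>, and after clearing denominators a polynomial identity
  remains.
\<close>

lemma dihedral_diff_adjacent_symmetric:
  assumes "lp > 0" "lq > 0" "face_gram (lp\<^sup>2) (lq\<^sup>2) s > 0"
  shows "dihedral_diff (lp\<^sup>2) (lq\<^sup>2) r s t k 0 (2 * lq) 0 0 0 0
       = dihedral_diff (lq\<^sup>2) (lp\<^sup>2) r s k t 0 (2 * lp) 0 0 0 0"
proof -
  define p q where pq: "p = lp\<^sup>2" "q = lq\<^sup>2"
  define Q D where QD: "Q = face_gram p q s" "D = sqrt (tet_gram p q r s t k)"
  \<comment> \<open>The two partial derivatives, without the factors that come from the lengths and the volume.\<close>
  define x where "x = p / 2 - (p + r - t) / 4 - dihedral_num p q r s t k / 2 * ((p - (p + q - s) / 2) / Q)"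
  define y where "y = q / 2 - (q + r - k) / 4 - dihedral_num q p r s k t / 2 * ((q - (p + q - s) / 2) / Q)"
  have Q: "Q > 0" using assms by (simp add: QD pq)
  have Q': "face_gram q p s = Q" by (simp add: QD face_gram_def algebra_simps)
  have "dihedral_diff p q r s t k 0 (2 * lq) 0 0 0 0 = - (2 * lq * x) / (lp * D)"
    using assms(1) unfolding dihedral_diff_def x_def QD(1)[symmetric]
    by (simp add: real_sqrt_mult pq(1)[symmetric] QD(2)) (simp add: pq(1) algebra_simps add_divide_distrib diff_divide_distrib)
  moreover have "dihedral_diff q p r s k t 0 (2 * lp) 0 0 0 0 = - (2 * lp * y) / (lq * D)"
    using assms(2) unfolding dihedral_diff_def y_def Q'
    by (simp add: real_sqrt_mult tet_gram_perms(1)[of q] QD(2)) (simp add: pq(2) algebra_simps add_divide_distrib diff_divide_distrib)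
  moreover have "q * x = p * y"
  proof -
    have "q * (2 * Q * (p / 2 - (p + r - t) / 4) - dihedral_num p q r s t k * (p - (p + q - s) / 2))
        = p * (2 * Q * (q / 2 - (q + r - k) / 4) - dihedral_num q p r s k t * (q - (p + q - s) / 2))"
      unfolding QD face_gram_def dihedral_num_def by (simp add: field_simps power2_eq_square)
    moreover have clear: "2 * Q * (a - n / 2 * (b / Q)) = 2 * Q * a - n * b" for a n b
      using Q by (simp add: field_simps)
    moreover have "2 * Q * x = 2 * Q * (p / 2 - (p + r - t) / 4) - dihedral_num p q r s t k * (p - (p + q - s) / 2)"
      unfolding x_def by (rule clear)
    moreover have "2 * Q * y = 2 * Q * (q / 2 - (q + r - k) / 4) - dihedral_num q p r s k t * (q - (p + q - s) / 2)"
      unfolding y_def by (rule clear)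
    ultimately have "2 * Q * (q * x) = 2 * Q * (p * y)" by (metis mult.left_commute)
    then show ?thesis using Q by simp
  qed
  then have "- (2 * lq * x) / (lp * D) = - (2 * lp * y) / (lq * D)"
    using assms(1,2) by (cases "D = 0") (simp_all add: pq field_simps power2_eq_square)
  ultimately show ?thesis by (simp add: pq)
qed

text \<open>
  For opposite edges both sides are the product of the two lengths divided by the square root of the
  Gram determinant, that is, by six times the volume.
\<close>

lemma dihedral_diff_opposite_symmetric:
  assumes "lp > 0" "lk > 0"
  shows "dihedral_diff (lp\<^sup>2) q r s t (lk\<^sup>2) 0 0 0 0 0 (2 * lk)
       = dihedral_diff (lk\<^sup>2) q s r t (lp\<^sup>2) 0 0 0 0 0 (2 * lp)"
  using assms unfolding dihedral_diff_def tet_gram_perms(2)[of "lp\<^sup>2"]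
  by (simp add: real_sqrt_mult) (simp add: power2_eq_square)

section \<open>The dihedral angle of a moving tetrahedron\<close>

text \<open>
  The speed at which the half-plane bounded by the line along \<open>u\<close> and containing \<open>v\<close> rotates
  about that line, measured against the frame that is parallel along the moving line.
\<close>

definition face_rate :: "real ^ 3 \<Rightarrow> real ^ 3 \<Rightarrow> real ^ 3 \<Rightarrow> real ^ 3 \<Rightarrow> real" where
  "face_rate u v u' v' = ((u \<times> perp_part u v) \<bullet> (v' - ((v \<bullet> u) / (u \<bullet> u)) *\<^sub>R u'))
     / (norm u * (perp_part u v \<bullet> perp_part u v))"

text \<open>
  Under a rotation with angular velocity \<open>\<omega>\<close> all half-planes at the edge turn with the component of
  \<open>\<omega>\<close> along the edge, whatever point \<open>v\<close> spans them.
\<close>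

lemma face_rate_rotation:
  assumes "u \<noteq> 0" "perp_part u v \<noteq> 0"
  shows "face_rate u v (\<omega> \<times> u) (\<omega> \<times> v) = (u \<bullet> \<omega>) / norm u"
proof -
  have "\<omega> \<times> v - ((v \<bullet> u) / (u \<bullet> u)) *\<^sub>R (\<omega> \<times> u) = \<omega> \<times> perp_part u v"
    by (simp add: perp_part_def Cross3.right_diff_distrib cross_mult_right)
  moreover have "(u \<times> a) \<bullet> (\<omega> \<times> a) = (u \<bullet> \<omega>) * (a \<bullet> a) - (u \<bullet> a) * (a \<bullet> \<omega>)" for a
    by (simp add: cross3_simps)
  ultimately show ?thesis
    using assms by (simp add: face_rate_def perp_part_orthogonal)
qed

lemma perp_part_cross:
  assumes "u \<noteq> 0"
  shows "perp_part u v \<times> perp_part u w = (det (vector [u, v, w] :: real ^ 3 ^ 3) / (u \<bullet> u)) *\<^sub>R u"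
proof -
  let ?z = "perp_part u v \<times> perp_part u w"
  have "u \<times> ?z = 0" by (simp add: Lagrange perp_part_orthogonal)
  then have "(u \<bullet> u) *\<^sub>R ?z = (u \<bullet> ?z) *\<^sub>R u" using Lagrange[of u u ?z] by simp
  moreover have "u \<bullet> ?z = det (vector [u, v, w] :: real ^ 3 ^ 3)"
    unfolding dot_cross_det[symmetric] perp_part_def
    by (simp add: Cross3.left_diff_distrib Cross3.right_diff_distrib cross_mult_left cross_mult_right
        inner_diff_right dot_cross_self)
  ultimately show ?thesis using assms
    by (metis (no_types, lifting) divide_inverse_commute inner_eq_zero_iff scaleR_left_imp_eq
        scaleR_scaleR vector_fraction_eq_iff)
qed

text \<open>
  The angle is determined by the components \<open>va\<close> and \<open>wa\<close> of \<open>v\<close> and \<open>w\<close> perpendicular to \<open>u\<close>. Up to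
  multiples of \<open>u\<close>, which are invisible in inner products with such components, they change by
  \<open>\<delta> v v'\<close> and \<open>\<delta> w w'\<close>. As \<open>va \<times> wa\<close> is a multiple of \<open>u\<close>, the gradient of the angle with respect to
  \<open>va\<close> is a multiple of \<open>u \<times> va\<close>, and the sign of the factor depends on that of the determinant.
\<close>

lemma dihedral_angle_has_derivative:
  fixes a b c d a' b' c' d' :: "real ^ 3"
  defines "u \<equiv> b - a" and "v \<equiv> c - a" and "w \<equiv> d - a"
    and "u' \<equiv> b' - a'" and "v' \<equiv> c' - a'" and "w' \<equiv> d' - a'"
  assumes nz: "det (vector [u, v, w] :: real ^ 3 ^ 3) \<noteq> 0"
  shows "((\<lambda>z. dihedral_angle (a + z *\<^sub>R a') (b + z *\<^sub>R b') (c + z *\<^sub>R c') (d + z *\<^sub>R d')) has_real_derivative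
    sgn (det (vector [u, v, w] :: real ^ 3 ^ 3)) * (face_rate u w u' w' - face_rate u v u' v')) (at 0)"
proof -
  have u0: "u \<noteq> 0"
    using nz by (auto simp flip: dot_cross_det)
  define uz where "uz z = u + z *\<^sub>R u'" for z
  define A where "A y y' z = perp_part (uz z) (y + z *\<^sub>R y')" for y y' :: "real ^ 3" and z
  define \<delta> where "\<delta> y y' = y' - ((y \<bullet> u) / (u \<bullet> u)) *\<^sub>R u'" for y y' :: "real ^ 3"
  have A0: "A y y' 0 = perp_part u y" for y y' by (simp add: A_def uz_def)
  have dA: "\<exists>h. (A y y' has_vector_derivative (\<delta> y y' - h *\<^sub>R u)) (at 0)" for y y'
  proof -
    have i: "((\<lambda>z. (x + z *\<^sub>R x') \<bullet> uz z) has_real_derivative (x \<bullet> u' + x' \<bullet> u)) (at 0)" for x x'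
      unfolding uz_def inner_add_left inner_add_right
      by (auto intro!: derivative_eq_intros simp: inner_commute)
    define f where "f z = ((y + z *\<^sub>R y') \<bullet> uz z) / (uz z \<bullet> uz z)" for z
    have "\<exists>h. (f has_real_derivative h) (at 0)"
      using DERIV_divide[OF i[of y y'] i[of u u']] u0 unfolding f_def uz_def by auto
    then obtain h where h: "(f has_real_derivative h) (at 0)" by blast
    have "A y y' = (\<lambda>z. y + z *\<^sub>R y' - f z *\<^sub>R (u + z *\<^sub>R u'))"
      by (simp add: fun_eq_iff A_def perp_part_def f_def uz_def)
    moreover have "((\<lambda>z. y + z *\<^sub>R y' - f z *\<^sub>R (u + z *\<^sub>R u')) has_vector_derivative
        (y' - (f 0 *\<^sub>R u' + h *\<^sub>R u))) (at 0)"
      by (auto intro!: derivative_eq_intros h)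
    ultimately have "(A y y' has_vector_derivative
        (y' - (((y \<bullet> u) / (u \<bullet> u)) *\<^sub>R u' + h *\<^sub>R u))) (at 0)"
      by (simp add: f_def uz_def)
    then show ?thesis by (intro exI[of _ h]) (simp add: \<delta>_def algebra_simps)
  qed
  have dI: "((\<lambda>z. A y y' z \<bullet> A x x' z) has_real_derivative
      (perp_part u y \<bullet> \<delta> x x' + \<delta> y y' \<bullet> perp_part u x)) (at 0)" for y y' x x'
  proof -
    obtain h g where h: "(A y y' has_vector_derivative (\<delta> y y' - h *\<^sub>R u)) (at 0)"
      and g: "(A x x' has_vector_derivative (\<delta> x x' - g *\<^sub>R u)) (at 0)" using dA by metis
    show ?thesis
      using bounded_bilinear.has_vector_derivative[OF bounded_bilinear_inner h g]
      by (simp add: A0 has_real_derivative_iff_has_vector_derivative inner_diff perp_part_orthogonal inner_commute)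
  qed
  define va wa where ab: "va = perp_part u v" "wa = perp_part u w"
  define \<kappa> where "\<kappa> = det (vector [u, v, w] :: real ^ 3 ^ 3) / (u \<bullet> u)"
  have \<kappa>: "\<kappa> \<noteq> 0" "sgn \<kappa> = sgn (det (vector [u, v, w] :: real ^ 3 ^ 3))"
    using u0 nz by (auto simp: \<kappa>_def sgn_divide)
  have cr: "va \<times> wa = \<kappa> *\<^sub>R u" using perp_part_cross[OF u0] by (simp add: ab \<kappa>_def)
  then have nza: "va \<noteq> 0" "wa \<noteq> 0" using \<kappa> u0 by auto
  have area: "(va \<bullet> va) * (wa \<bullet> wa) - (va \<bullet> wa)\<^sup>2 = (\<bar>\<kappa>\<bar> * norm u)\<^sup>2"
    using norm_cross_dot[of va wa] unfolding cr by (simp add: power_mult_distrib power2_norm_eq_inner)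
  have e1: "(va \<bullet> va) *\<^sub>R wa - (va \<bullet> wa) *\<^sub>R va = \<kappa> *\<^sub>R (u \<times> va)"
  proof -
    have "va \<times> (wa \<times> va) = - (va \<times> (\<kappa> *\<^sub>R u))"
      using cr by (metis cross_minus_right cross_skew)
    also have "\<dots> = \<kappa> *\<^sub>R (u \<times> va)" by (metis cross_mult_right cross_skew scaleR_minus_right)
    finally show ?thesis by (simp add: Lagrange)
  qed
  have e2: "(wa \<bullet> wa) *\<^sub>R va - (va \<bullet> wa) *\<^sub>R wa = - (\<kappa> *\<^sub>R (u \<times> wa))"
  proof -
    have "wa \<times> (va \<times> wa) = - (\<kappa> *\<^sub>R (u \<times> wa))"
      unfolding cr by (metis cross_mult_right cross_skew scaleR_minus_right)
    then show ?thesis by (simp add: Lagrange inner_commute)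
  qed
  have angle: "dihedral_angle (a + z *\<^sub>R a') (b + z *\<^sub>R b') (c + z *\<^sub>R c') (d + z *\<^sub>R d') =
      arccos ((A v v' z \<bullet> A w w' z) / (sqrt (A v v' z \<bullet> A v v' z) * sqrt (A w w' z \<bullet> A w w' z)))" for z
  proof -
    have "(b + z *\<^sub>R b') - (a + z *\<^sub>R a') = uz z" "(c + z *\<^sub>R c') - (a + z *\<^sub>R a') = v + z *\<^sub>R v'"
      "(d + z *\<^sub>R d') - (a + z *\<^sub>R a') = w + z *\<^sub>R w'"
      by (simp_all add: uz_def u_def v_def w_def u'_def v'_def w'_def algebra_simps)
    then show ?thesis by (simp add: dihedral_angle_def A_def norm_eq_sqrt_inner Let_def)
  qed
  have "((\<lambda>z. arccos ((A v v' z \<bullet> A w w' z) / (sqrt (A v v' z \<bullet> A v v' z) * sqrt (A w w' z \<bullet> A w w' z))))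
    has_real_derivative
      - ((va \<bullet> \<delta> w w' + \<delta> v v' \<bullet> wa) - (A v v' 0 \<bullet> A w w' 0) / 2 *
         ((va \<bullet> \<delta> v v' + \<delta> v v' \<bullet> va) / (A v v' 0 \<bullet> A v v' 0) + (wa \<bullet> \<delta> w w' + \<delta> w w' \<bullet> wa) / (A w w' 0 \<bullet> A w w' 0)))
      / sqrt ((A v v' 0 \<bullet> A v v' 0) * (A w w' 0 \<bullet> A w w' 0) - (A v v' 0 \<bullet> A w w' 0)\<^sup>2)) (at 0)"
    unfolding ab
  proof (rule DERIV_arccos_quotient[OF dI dI dI])
    show "A v v' 0 \<bullet> A v v' 0 > 0" "A w w' 0 \<bullet> A w w' 0 > 0"
      using nza by (auto simp: A0 ab)
    show "(A v v' 0 \<bullet> A v v' 0) * (A w w' 0 \<bullet> A w w' 0) - (A v v' 0 \<bullet> A w w' 0)\<^sup>2 > 0"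
      using area \<kappa>(1) u0 by (simp add: A0 ab)
  qed
  moreover have "- ((va \<bullet> \<delta> w w' + \<delta> v v' \<bullet> wa) - (A v v' 0 \<bullet> A w w' 0) / 2 *
         ((va \<bullet> \<delta> v v' + \<delta> v v' \<bullet> va) / (A v v' 0 \<bullet> A v v' 0) + (wa \<bullet> \<delta> w w' + \<delta> w w' \<bullet> wa) / (A w w' 0 \<bullet> A w w' 0)))
      / sqrt ((A v v' 0 \<bullet> A v v' 0) * (A w w' 0 \<bullet> A w w' 0) - (A v v' 0 \<bullet> A w w' 0)\<^sup>2)
    = sgn \<kappa> * (face_rate u w u' w' - face_rate u v u' v')" (is "- ?N / ?S = _")
  proof -
    have S: "?S = \<bar>\<kappa>\<bar> * norm u" unfolding A0 ab[symmetric] area by simp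
    have "?N = \<delta> v v' \<bullet> ((va \<bullet> va) *\<^sub>R wa - (va \<bullet> wa) *\<^sub>R va) / (va \<bullet> va)
        + \<delta> w w' \<bullet> ((wa \<bullet> wa) *\<^sub>R va - (va \<bullet> wa) *\<^sub>R wa) / (wa \<bullet> wa)"
      using nza unfolding A0 ab[symmetric] by (simp add: inner_diff_right inner_commute field_simps)
    also have "\<dots> = \<kappa> * (\<delta> v v' \<bullet> (u \<times> va) / (va \<bullet> va) - \<delta> w w' \<bullet> (u \<times> wa) / (wa \<bullet> wa))"
      unfolding e1 e2 by (simp add: algebra_simps)
    finally have N: "?N = \<kappa> * (\<delta> v v' \<bullet> (u \<times> va) / (va \<bullet> va) - \<delta> w w' \<bullet> (u \<times> wa) / (wa \<bullet> wa))" .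
    have F: "face_rate u v u' v' = \<delta> v v' \<bullet> (u \<times> va) / (va \<bullet> va) / norm u"
      "face_rate u w u' w' = \<delta> w w' \<bullet> (u \<times> wa) / (wa \<bullet> wa) / norm u"
      by (simp_all add: face_rate_def \<delta>_def ab inner_commute mult.commute)
    show ?thesis
    proof (cases "\<kappa> > 0")
      case True
      then show ?thesis unfolding S N F using u0 by (simp add: field_simps)
    next
      case False
      then have "\<kappa> < 0" using \<kappa>(1) by simp
      then show ?thesis unfolding S N F using u0 by (simp add: field_simps)
    qed
  qed
  ultimately show ?thesis unfolding angle \<kappa>(2) by simp
qed

section \<open>Tetrahedra with labelled vertices\<close>

lemma edge_length_eq: "verts T e = {A, B} \<Longrightarrow> edge_length T y e = dist (y A) (y B)"
  unfolding edge_length_def by (rule the_equality) (auto simp: doubleton_eq_iff dist_commute)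

definition edge_between :: "('p, 'v, 'c) triang \<Rightarrow> 'c \<Rightarrow> 'v \<Rightarrow> 'v \<Rightarrow> 'c" where
  "edge_between T t A B = (THE e. is_face T e t \<and> verts T e = {A, B})"

definition sq_length :: "('p, 'v, 'c) triang \<Rightarrow> ('c \<Rightarrow> real) \<Rightarrow> 'c \<Rightarrow> 'v \<Rightarrow> 'v \<Rightarrow> real" where
  "sq_length T l t A B = (l (edge_between T t A B))\<^sup>2"

text \<open>
  The function \<open>dihedral_sq\<close> and its differential, for the tetrahedron \<open>t\<close> with labelled vertices and
  for lengths prescribed by \<open>l\<close>. In \<open>dihedral_diff_at\<close>, \<open>m\<close> contains the changes of the lengths,
  not of their squares.
\<close>

definition dihedral_at ::
  "('p, 'v, 'c) triang \<Rightarrow> ('c \<Rightarrow> real) \<Rightarrow> 'c \<Rightarrow> 'v \<Rightarrow> 'v \<Rightarrow> 'v \<Rightarrow> 'v \<Rightarrow> real" where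
  "dihedral_at T l t A B C D = dihedral_sq (sq_length T l t A B) (sq_length T l t A C)
     (sq_length T l t A D) (sq_length T l t B C) (sq_length T l t B D) (sq_length T l t C D)"

definition nondegenerate_at ::
  "('p, 'v, 'c) triang \<Rightarrow> ('c \<Rightarrow> real) \<Rightarrow> 'c \<Rightarrow> 'v \<Rightarrow> 'v \<Rightarrow> 'v \<Rightarrow> 'v \<Rightarrow> bool" where
  "nondegenerate_at T l t A B C D \<longleftrightarrow>
     (\<forall>X \<in> {A, B, C, D}. \<forall>Y \<in> {A, B, C, D}. X \<noteq> Y \<longrightarrow> l (edge_between T t X Y) > 0) \<and>
     face_gram (sq_length T l t A B) (sq_length T l t A C) (sq_length T l t B C) > 0 \<and>
     face_gram (sq_length T l t A B) (sq_length T l t A D) (sq_length T l t B D) > 0 \<and>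
     tet_gram (sq_length T l t A B) (sq_length T l t A C) (sq_length T l t A D)
       (sq_length T l t B C) (sq_length T l t B D) (sq_length T l t C D) > 0"

definition dihedral_diff_at ::
  "('p, 'v, 'c) triang \<Rightarrow> ('c \<Rightarrow> real) \<Rightarrow> 'c \<Rightarrow> 'v \<Rightarrow> 'v \<Rightarrow> 'v \<Rightarrow> 'v \<Rightarrow> ('c \<Rightarrow> real) \<Rightarrow> real" where
  "dihedral_diff_at T l t A B C D m =
     (let d = (\<lambda>X Y. 2 * l (edge_between T t X Y) * m (edge_between T t X Y)) in
      dihedral_diff (sq_length T l t A B) (sq_length T l t A C)
       (sq_length T l t A D) (sq_length T l t B C) (sq_length T l t B D) (sq_length T l t C D)
       (d A B) (d A C) (d A D) (d B C) (d B D) (d C D))"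

lemma edge_between_commute: "edge_between T t A B = edge_between T t B A"
  by (simp add: edge_between_def insert_commute)

lemma sq_length_commute: "sq_length T l t A B = sq_length T l t B A"
  by (simp add: sq_length_def edge_between_commute)

lemma dihedral_at_swaps:
  "dihedral_at T l t B A C D = dihedral_at T l t A B C D"
  "dihedral_at T l t A B D C = dihedral_at T l t A B C D"
  unfolding dihedral_at_def
  by (subst dihedral_sq_swap_ends; simp add: sq_length_commute[of _ _ _ B A])
     (subst dihedral_sq_swap_faces; simp add: sq_length_commute[of _ _ _ D C])

lemma (in triangulated_manifold) tetrahedron_distinct:
  assumes "t \<in> tetrahedra T" "verts T t = {A, B, C, D}"
  shows "distinct [A, B, C, D]"
proof -
  have "card (set [A, B, C, D]) = length [A, B, C, D]" using assms by (simp add: tetrahedra_def)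
  then show ?thesis by (rule card_distinct)
qed

locale generic_manifold = triangulated_manifold M T
  for M :: "'p topology" and T :: "('p, 'v, 'c) triang" +
  fixes orn :: "'c \<Rightarrow> 'v list \<Rightarrow> int" and x :: "'v \<Rightarrow> real ^ 3"
  assumes orients: "orients orn T" and generic: "generic_coords T orn x"
    and finite_components: "finite (bdry_components M)"
begin

abbreviation "L \<equiv> edge_length T x"

lemma tet_cells: "t \<in> tetrahedra T \<Longrightarrow> t \<in> cells T"
  by (simp add: tetrahedra_def)

lemma finite_tetrahedra: "finite (tetrahedra T)"
  using finite_cells by (rule rev_finite_subset) (auto simp: tetrahedra_def)

lemma finite_edges: "finite (edges T)"
  using finite_cells by (rule rev_finite_subset) (auto simp: edges_def)

lemma edge_between_eqI: "is_face T e t \<Longrightarrow> verts T e = {A, B} \<Longrightarrow> edge_between T t A B = e"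
  unfolding edge_between_def using face_unique by (intro the_equality) auto

lemma edge_between:
  assumes "t \<in> tetrahedra T" "A \<in> verts T t" "B \<in> verts T t" "A \<noteq> B"
  shows "is_face T (edge_between T t A B) t" "verts T (edge_between T t A B) = {A, B}"
    "edge_between T t A B \<in> edges T"
proof -
  obtain e where e: "is_face T e t" "verts T e = {A, B}"
    using face_exists[OF tet_cells[OF assms(1)], of "{A, B}"] assms by auto
  then have "edge_between T t A B = e" by (rule edge_between_eqI)
  then show "is_face T (edge_between T t A B) t" "verts T (edge_between T t A B) = {A, B}"
    "edge_between T t A B \<in> edges T"
    using e assms(4) face_cells by (auto simp: edges_def)
qed

lemma edge_verts:
  assumes "e \<in> edges T"
  obtains A B where "verts T e = {A, B}" "A \<noteq> B"
  using assms by (auto simp: edges_def card_2_iff)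

lemma tetrahedron_labels:
  assumes "t \<in> tetrahedra T" "is_face T i t" "verts T i = {A, B}" "A \<noteq> B"
  obtains C D where "verts T t = {A, B, C, D}"
proof -
  have "card (verts T t - {A, B}) = 2"
    using assms face_verts[OF assms(2)] by (subst card_Diff_subset) (auto simp: tetrahedra_def)
  then obtain C D where "verts T t - {A, B} = {C, D}" by (auto simp: card_2_iff)
  then have "verts T t = {A, B, C, D}" using face_verts[OF assms(2)] assms(3) by auto
  then show ?thesis using that by blast
qed

lemma tetrahedron_edges:
  assumes t: "t \<in> tetrahedra T" and v: "verts T t = {A, B, C, D}"
  shows "{e \<in> edges T. is_face T e t} = {edge_between T t A B, edge_between T t A C, edge_between T t A D,
      edge_between T t B C, edge_between T t B D, edge_between T t C D}" (is "?l = ?r")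
proof
  show "?r \<subseteq> ?l" using edge_between[OF t] v tetrahedron_distinct[OF t v] by auto
  show "?l \<subseteq> ?r"
  proof
    fix e assume e: "e \<in> ?l"
    then obtain X Y where XY: "verts T e = {X, Y}" "X \<noteq> Y" using edge_verts by blast
    then have "edge_between T t X Y = e" using e edge_between_eqI by blast
    moreover have "X \<in> {A, B, C, D}" "Y \<in> {A, B, C, D}" using face_verts[of e t] e v XY by auto
    ultimately show "e \<in> ?r"
      using XY(2) by (auto simp: edge_between_commute[of T t B A] edge_between_commute[of T t C A]
          edge_between_commute[of T t D A] edge_between_commute[of T t C B]
          edge_between_commute[of T t D B] edge_between_commute[of T t D C])
  qed
qed

lemma edge_between_inj:
  assumes "t \<in> tetrahedra T" "A \<in> verts T t" "B \<in> verts T t" "A \<noteq> B"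
    "A' \<in> verts T t" "B' \<in> verts T t" "A' \<noteq> B'"
  shows "edge_between T t A B = edge_between T t A' B' \<longleftrightarrow> {A, B} = {A', B'}"
proof
  show "{A, B} = {A', B'}" if "edge_between T t A B = edge_between T t A' B'"
    using edge_between(2)[OF assms(1-4)] edge_between(2)[OF assms(1,5-7)] that by simp
  show "edge_between T t A B = edge_between T t A' B'" if "{A, B} = {A', B'}"
    unfolding edge_between_def that ..
qed

section \<open>Volumes\<close>

abbreviation "vdet A B C D \<equiv> det (vector [x B - x A, x C - x A, x D - x A] :: real ^ 3 ^ 3)"

lemma orn_values:
  assumes "t \<in> tetrahedra T" "verts T t = {A, B, C, D}"
  shows "orn t [A, B, C, D] \<in> {1, -1}"
proof -
  have "distinct [A, B, C, D] \<and> set [A, B, C, D] = verts T t"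
    using tetrahedron_distinct[OF assms] assms(2) by simp
  then show ?thesis using orients assms(1) unfolding orients_def by blast
qed

lemma orn_swaps:
  assumes t: "t \<in> tetrahedra T" and v: "verts T t = {A, B, C, D}"
  shows "orn t [B, A, C, D] = - orn t [A, B, C, D]" "orn t [A, C, B, D] = - orn t [A, B, C, D]"
    "orn t [A, B, D, C] = - orn t [A, B, C, D]"
proof -
  have "distinct [A, B, C, D] \<and> set [A, B, C, D] = verts T t"
    using tetrahedron_distinct[OF t v] v by simp
  then have perm: "orn t (permute_list \<pi> [A, B, C, D]) = sign \<pi> * orn t [A, B, C, D]"
    if "\<pi> permutes {..<4}" for \<pi> :: "nat \<Rightarrow> nat"
    using orients t that unfolding orients_def by blast
  have swap: "orn t (permute_list (Transposition.transpose i j) [A, B, C, D]) = - orn t [A, B, C, D]"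
    if "i < 4" "j < 4" "i \<noteq> j" for i j :: nat
    using perm[of "Transposition.transpose i j"] that by (simp add: permutes_swap_id sign_swap_id)
  show "orn t [B, A, C, D] = - orn t [A, B, C, D]" "orn t [A, C, B, D] = - orn t [A, B, C, D]"
    "orn t [A, B, D, C] = - orn t [A, B, C, D]"
    using swap[of 0 1] swap[of 1 2] swap[of 2 3]
    by (simp_all add: permute_list_def upt_rec Transposition.transpose_def numeral_2_eq_2 numeral_3_eq_3)
qed

lemma vdet_swaps:
  "vdet B A C D = - vdet A B C D" "vdet A C B D = - vdet A B C D" "vdet A B D C = - vdet A B C D"
  by (simp_all add: det_3 algebra_simps)

text \<open>
  The permutations of four labels are generated by the exchanges of neighbours. A label is moved to the
  front by such exchanges, then the next one behind it.
\<close>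

lemma swaps_invariant:
  assumes v: "distinct [A, B, C, D]" and v': "{A', B', C', D'} = {A, B, C, D}"
    and sw: "\<And>A B C D. {A, B, C, D} = S \<Longrightarrow> g B A C D = g A B C D \<and> g A C B D = g A B C D \<and> g A B D C = g A B C D"
    and S: "S = {A, B, C, D}"
  shows "g A' B' C' D' = g A B C D"
proof -
  have s1: "g X W Y Z = g W X Y Z" and s2: "g W Y X Z = g W X Y Z" and s3: "g W X Z Y = g W X Y Z"
    if "{W, X, Y, Z} = S" for W X Y Z using sw[OF that] by auto
  have s12: "g Y W X Z = g W X Y Z" and s23: "g W Z X Y = g W X Y Z" if "{W, X, Y, Z} = S" for W X Y Z
    using s2[OF that] s1[of W Y X Z] s3[OF that] s2[of W X Z Y] that by (auto simp: insert_commute)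
  have s123: "g Z W X Y = g W X Y Z" if "{W, X, Y, Z} = S" for W X Y Z
    using s23[OF that] s1[of W Z X Y] that by (auto simp: insert_commute)
  have S': "{A', B', C', D'} = S" using v' S by simp
  have "A \<in> {A', B', C', D'}" unfolding v' by simp
  then have "\<exists>B1 C1 D1. {A, B1, C1, D1} = S \<and> g A' B' C' D' = g A B1 C1 D1"
  proof (elim insertE emptyE)
    assume "A = A'"
    then show ?thesis using S' by blast
  next
    assume "A = B'"
    then show ?thesis using s1[OF S'] S' by (metis insert_commute)
  next
    assume "A = C'"
    then show ?thesis using s12[OF S'] S' by (metis insert_commute)
  next
    assume "A = D'"
    then show ?thesis using s123[OF S'] S' by (metis insert_commute)
  qed
  then obtain B1 C1 D1 where 1: "{A, B1, C1, D1} = S" "g A' B' C' D' = g A B1 C1 D1" by blast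
  have "B \<in> {B1, C1, D1}" using 1(1) S v by auto
  then have "\<exists>C2 D2. {A, B, C2, D2} = S \<and> g A B1 C1 D1 = g A B C2 D2"
  proof (elim insertE emptyE)
    assume "B = B1"
    then show ?thesis using 1 by blast
  next
    assume "B = C1"
    then show ?thesis using s2[OF 1(1)] 1 by (metis insert_commute)
  next
    assume "B = D1"
    then show ?thesis using s23[OF 1(1)] 1 by (metis insert_commute)
  qed
  then obtain C2 D2 where 2: "{A, B, C2, D2} = S" "g A B1 C1 D1 = g A B C2 D2" by blast
  have "C \<in> {C2, D2}" "D \<in> {C2, D2}" using 2(1) S v by auto
  then show ?thesis using 1(2) 2 s3[OF 2(1)] v by auto
qed

text \<open>
  The orientation sign and the determinant both change sign when two vertices are exchanged.
\<close>

lemma oriented_volume_eq: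
  assumes t: "t \<in> tetrahedra T" and v: "verts T t = {A, B, C, D}"
  shows "oriented_volume T orn x t = of_int (orn t [A, B, C, D]) * vdet A B C D / 6"
proof -
  let ?g = "\<lambda>A B C D. of_int (orn t [A, B, C, D]) * vdet A B C D / 6"
  have sw: "?g B A C D = ?g A B C D \<and> ?g A C B D = ?g A B C D \<and> ?g A B D C = ?g A B C D"
    if "{A, B, C, D} = verts T t" for A B C D
    unfolding orn_swaps[OF t that[symmetric]]
      vdet_swaps[where A = A and B = B and C = C and D = D] by simp
  show ?thesis
    unfolding oriented_volume_def
  proof (rule the_equality)
    show "\<exists>A' B' C' D'. verts T t = {A', B', C', D'} \<and> ?g A B C D = ?g A' B' C' D'"
      using v by blast
    fix V assume "\<exists>A' B' C' D'. verts T t = {A', B', C', D'} \<and> V = ?g A' B' C' D'"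
    then obtain A' B' C' D' where V: "verts T t = {A', B', C', D'}" "V = ?g A' B' C' D'" by blast
    show "V = ?g A B C D"
      unfolding V(2)
      by (rule swaps_invariant[of A B C D A' B' C' D' "verts T t" ?g,
            OF tetrahedron_distinct[OF t v] _ sw v]) (use V v in auto)
  qed
qed

lemma vdet_nonzero:
  assumes "t \<in> tetrahedra T" "verts T t = {A, B, C, D}"
  shows "vdet A B C D \<noteq> 0"
  using generic assms oriented_volume_eq[OF assms] by (auto simp: generic_coords_def)

lemma sgn_volume:
  assumes "t \<in> tetrahedra T" "verts T t = {A, B, C, D}"
  shows "sgn (oriented_volume T orn x t) = of_int (orn t [A, B, C, D]) * sgn (vdet A B C D)"
  using orn_values[OF assms] unfolding oriented_volume_eq[OF assms]
  by (auto simp: sgn_mult sgn_divide)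

lemma edge_points_distinct:
  assumes "t \<in> tetrahedra T" "verts T t = {A, B, C, D}"
  shows "x A \<noteq> x B"
proof
  assume "x A = x B"
  then have "vdet A B C D = 0" by (simp flip: dot_cross_det)
  then show False using vdet_nonzero[OF assms] by simp
qed

lemma edge_ends_distinct:
  assumes "i \<in> edges T" "verts T i = {A, B}"
  shows "x A \<noteq> x B"
proof -
  obtain t where "t \<in> tetrahedra T" "is_face T i t" using edge_in_tetrahedron assms by blast
  moreover have "A \<noteq> B" using assms by (auto simp: edges_def)
  ultimately show ?thesis using tetrahedron_labels edge_points_distinct assms(2) by metis
qed

section \<open>Dihedral angles near the unperturbed lengths\<close>

lemma realizes_lengths_iff:
  assumes t: "t \<in> tetrahedra T"
  shows "realizes_lengths T l t y \<longleftrightarrow>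
    (\<forall>X \<in> verts T t. \<forall>Y \<in> verts T t. X \<noteq> Y \<longrightarrow> dist (y X) (y Y) = l (edge_between T t X Y))"
proof
  assume r: "realizes_lengths T l t y"
  show "\<forall>X \<in> verts T t. \<forall>Y \<in> verts T t. X \<noteq> Y \<longrightarrow> dist (y X) (y Y) = l (edge_between T t X Y)"
  proof (intro ballI impI)
    fix X Y assume "X \<in> verts T t" "Y \<in> verts T t" "X \<noteq> Y"
    note e = edge_between[OF t this]
    then show "dist (y X) (y Y) = l (edge_between T t X Y)"
      using r edge_length_eq[OF e(2), of y] by (auto simp: realizes_lengths_def)
  qed
next
  assume r: "\<forall>X \<in> verts T t. \<forall>Y \<in> verts T t. X \<noteq> Y \<longrightarrow> dist (y X) (y Y) = l (edge_between T t X Y)"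
  show "realizes_lengths T l t y"
    unfolding realizes_lengths_def
  proof (intro ballI impI)
    fix e assume e: "e \<in> edges T" "is_face T e t"
    obtain X Y where XY: "verts T e = {X, Y}" "X \<noteq> Y" using edge_verts e by blast
    then show "edge_length T y e = l e"
      using r face_verts[OF e(2)] edge_between_eqI[OF e(2) XY(1)] edge_length_eq[OF XY(1), of y] by auto
  qed
qed

lemma dihedral_angle_realized:
  assumes t: "t \<in> tetrahedra T" and v: "verts T t = {A, B, C, D}"
    and y: "realizes_lengths T l t y" and nd: "y A \<noteq> y B"
  shows "dihedral_angle (y A) (y B) (y C) (y D) = dihedral_at T l t A B C D"
proof -
  have "dist (y X) (y Y) = l (edge_between T t X Y)" if "X \<in> verts T t" "Y \<in> verts T t" "X \<noteq> Y" for X Y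
    using y that unfolding realizes_lengths_iff[OF t] by blast
  then show ?thesis
    using tetrahedron_distinct[OF t v]
    unfolding dihedral_angle_eq_dihedral_sq[OF nd] dihedral_at_def sq_length_def v by simp
qed

text \<open>
  Existence of a realization makes the description in \<open>dihedral_of_lengths\<close> meaningful. It is
  unambiguous since the angle depends on the lengths only and, for a given edge, the labels are
  determined up to the two exchanges in \<open>dihedral_at_swaps\<close>.
\<close>

lemma dihedral_of_lengths_eq:
  assumes t: "t \<in> tetrahedra T" and v: "verts T t = {A, B, C, D}"
    and nd: "nondegenerate_at T l t A B C D"
  shows "dihedral_of_lengths T l t (edge_between T t A B) = dihedral_at T l t A B C D"
  unfolding dihedral_of_lengths_def
proof (rule the_equality)
  have dis: "distinct [A, B, C, D]" using tetrahedron_distinct[OF t v] .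
  have pos: "l (edge_between T t X Y) > 0" if "X \<in> verts T t" "Y \<in> verts T t" "X \<noteq> Y" for X Y
    using nd that v unfolding nondegenerate_at_def by blast
  have vi: "verts T (edge_between T t A B) = {A, B}" using edge_between[OF t] v dis by simp
  have "sq_length T l t A B > 0" using pos[of A B] dis v by (simp add: sq_length_def)
  then obtain a b c d :: "real ^ 3" where abcd:
    "(dist a b)\<^sup>2 = sq_length T l t A B" "(dist a c)\<^sup>2 = sq_length T l t A C"
    "(dist a d)\<^sup>2 = sq_length T l t A D" "(dist b c)\<^sup>2 = sq_length T l t B C"
    "(dist b d)\<^sup>2 = sq_length T l t B D" "(dist c d)\<^sup>2 = sq_length T l t C D"
    using nd tetrahedron_realization unfolding nondegenerate_at_def by metis
  define y where "y = (\<lambda>X. if X = A then a else if X = B then b else if X = C then c else d)"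
  have yv: "y A = a" "y B = b" "y C = c" "y D = d" using dis by (auto simp: y_def)
  have "(dist (y X) (y Y))\<^sup>2 = sq_length T l t X Y" if "X \<in> verts T t" "Y \<in> verts T t" "X \<noteq> Y" for X Y
  proof -
    have abcd': "(dist b a)\<^sup>2 = sq_length T l t B A" "(dist c a)\<^sup>2 = sq_length T l t C A"
      "(dist d a)\<^sup>2 = sq_length T l t D A" "(dist c b)\<^sup>2 = sq_length T l t C B"
      "(dist d b)\<^sup>2 = sq_length T l t D B" "(dist d c)\<^sup>2 = sq_length T l t D C"
      using abcd
      by (simp_all only: dist_commute[of b a] dist_commute[of c a] dist_commute[of c b]
          dist_commute[of d a] dist_commute[of d b] dist_commute[of d c]
          sq_length_commute[of T l t B A] sq_length_commute[of T l t C A] sq_length_commute[of T l t C B]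
          sq_length_commute[of T l t D A] sq_length_commute[of T l t D B] sq_length_commute[of T l t D C])
    have "X \<in> {A, B, C, D}" "Y \<in> {A, B, C, D}" using that v by auto
    then show ?thesis
      using \<open>X \<noteq> Y\<close> by (elim insertE emptyE) (simp_all add: yv abcd abcd')
  qed
  then have y: "realizes_lengths T l t y"
    unfolding realizes_lengths_iff[OF t] sq_length_def
    using pos by (meson less_imp_le power2_eq_imp_eq zero_le_dist)
  have ne: "z X \<noteq> z Y" if "realizes_lengths T l t z" "X \<in> verts T t" "Y \<in> verts T t" "X \<noteq> Y" for z X Y
    using that pos unfolding realizes_lengths_iff[OF t] by fastforce
  show "\<exists>y A' B' C' D'. realizes_lengths T l t y \<and> verts T (edge_between T t A B) = {A', B'} \<and>
      verts T t = {A', B', C', D'} \<and>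
      dihedral_at T l t A B C D = dihedral_angle (y A') (y B') (y C') (y D')"
  proof -
    have "y A \<noteq> y B" using ne[OF y, of A B] v dis by simp
    then have "dihedral_at T l t A B C D = dihedral_angle (y A) (y B) (y C) (y D)"
      using dihedral_angle_realized[OF t v y] by simp
    then show ?thesis using y vi v by blast
  qed
  fix \<theta>
  assume "\<exists>y A' B' C' D'. realizes_lengths T l t y \<and> verts T (edge_between T t A B) = {A', B'} \<and>
      verts T t = {A', B', C', D'} \<and> \<theta> = dihedral_angle (y A') (y B') (y C') (y D')"
  then obtain z A' B' C' D' where z: "realizes_lengths T l t z" "verts T (edge_between T t A B) = {A', B'}"
      "verts T t = {A', B', C', D'}" "\<theta> = dihedral_angle (z A') (z B') (z C') (z D')" by blast
  have dis': "distinct [A', B', C', D']" using tetrahedron_distinct[OF t z(3)] .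
  have "\<theta> = dihedral_at T l t A' B' C' D'"
    unfolding z(4) using ne[OF z(1), of A' B'] dis' z(3)
    by (intro dihedral_angle_realized[OF t z(3,1)]) auto
  moreover have "(A' = A \<and> B' = B) \<or> (A' = B \<and> B' = A)" using z(2) vi by (auto simp: doubleton_eq_iff)
  moreover have "{C', D'} = {C, D}"
  proof -
    have "{C', D'} = verts T t - {A', B'}" using z(3) dis' by auto
    also have "\<dots> = verts T t - {A, B}" using z(2) vi by simp
    also have "\<dots> = {C, D}" using v dis by auto
    finally show ?thesis .
  qed
  then have "(C' = C \<and> D' = D) \<or> (C' = D \<and> D' = C)" by (auto simp: doubleton_eq_iff)
  ultimately show "\<theta> = dihedral_at T l t A B C D" by (auto simp: dihedral_at_swaps)
qed

lemma sq_length_unperturbed: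
  assumes "t \<in> tetrahedra T" "X \<in> verts T t" "Y \<in> verts T t" "X \<noteq> Y"
  shows "sq_length T L t X Y = (dist (x X) (x Y))\<^sup>2"
  using edge_between[OF assms] by (simp add: sq_length_def edge_length_eq)

lemma nondegenerate_unperturbed:
  assumes t: "t \<in> tetrahedra T" and v: "verts T t = {A, B, C, D}"
  shows "nondegenerate_at T L t A B C D"
proof -
  have dis: "distinct [A, B, C, D]" using tetrahedron_distinct[OF t v] .
  have det: "vdet A B C D \<noteq> 0" using vdet_nonzero[OF t v] .
  have "L (edge_between T t X Y) > 0" if "X \<in> verts T t" "Y \<in> verts T t" "X \<noteq> Y" for X Y
    using edge_between[OF t that] edge_ends_distinct by (simp add: edge_length_eq)
  moreover have "(x B - x A) \<times> (x C - x A) \<noteq> 0" "(x B - x A) \<times> (x D - x A) \<noteq> 0"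
  proof -
    have "(x D - x A) \<bullet> ((x B - x A) \<times> (x C - x A)) = vdet A B C D"
      "(x C - x A) \<bullet> ((x B - x A) \<times> (x D - x A)) = - vdet A B C D"
      unfolding dot_cross_det by (simp_all add: det_3 algebra_simps)
    then show "(x B - x A) \<times> (x C - x A) \<noteq> 0" "(x B - x A) \<times> (x D - x A) \<noteq> 0" using det by auto
  qed
  ultimately show ?thesis
    using dis det unfolding nondegenerate_at_def
    by (simp add: sq_length_unperturbed[OF t] v face_gram_eq_cross tet_gram_eq_det)
qed

text \<open>
  Stated along an arbitrary path of lengths, this covers both the partial derivatives that define \<open>F3\<close>
  and the changes of lengths caused by a motion of the vertices. Nondegeneracy is an open
  condition, so that \<open>dihedral_of_lengths\<close> agrees with the explicit formula along the path near the
  unperturbed lengths.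
\<close>

lemma dihedral_of_lengths_has_derivative:
  assumes t: "t \<in> tetrahedra T" and v: "verts T t = {A, B, C, D}"
    and d: "\<And>e. e \<in> edges T \<Longrightarrow> is_face T e t \<Longrightarrow> ((\<lambda>z. l z e) has_real_derivative m e) (at z0)"
    and l0: "l z0 = L"
  shows "((\<lambda>z. dihedral_at T (l z) t A B C D) has_real_derivative dihedral_diff_at T L t A B C D m) (at z0)"
      (is "(?f has_real_derivative _) _")
    and "((\<lambda>z. dihedral_of_lengths T (l z) t (edge_between T t A B)) has_real_derivative
      dihedral_diff_at T L t A B C D m) (at z0)"
proof -
  have dis: "distinct [A, B, C, D]" using tetrahedron_distinct[OF t v] .
  have nd: "nondegenerate_at T L t A B C D" using nondegenerate_unperturbed[OF t v] .
  have de: "((\<lambda>z. l z (edge_between T t X Y)) has_real_derivative m (edge_between T t X Y)) (at z0)"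
    if "X \<in> verts T t" "Y \<in> verts T t" "X \<noteq> Y" for X Y
    using d edge_between[OF t that] by blast
  have dsq: "((\<lambda>z. sq_length T (l z) t X Y) has_real_derivative
      2 * L (edge_between T t X Y) * m (edge_between T t X Y)) (at z0)"
    if "X \<in> verts T t" "Y \<in> verts T t" "X \<noteq> Y" for X Y
    unfolding sq_length_def using l0 by (auto intro!: derivative_eq_intros de[OF that])
  have abp: "sq_length T L t A B > 0"
    using nd dis unfolding nondegenerate_at_def sq_length_def by auto
  show f: "(?f has_real_derivative dihedral_diff_at T L t A B C D m) (at z0)"
    unfolding dihedral_at_def dihedral_diff_at_def Let_def l0[symmetric]
    by (rule dihedral_sq_has_derivative)
       (use dsq v dis nd abp in \<open>auto simp: l0 nondegenerate_at_def\<close>)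
  have ev: "\<forall>\<^sub>F z in nhds z0. h z > 0" if "isCont h z0" "h z0 > 0" for h :: "real \<Rightarrow> real"
  proof -
    have "(h \<longlongrightarrow> h z0) (nhds z0)"
      using that(1) by (simp add: isCont_def tendsto_at_iff_tendsto_nhds)
    then show ?thesis using that(2) order_tendstoD(1) by blast
  qed
  have ce: "isCont (\<lambda>z. l z (edge_between T t X Y)) z0" if "X \<in> verts T t" "Y \<in> verts T t" "X \<noteq> Y" for X Y
    using de[OF that] DERIV_isCont by blast
  have csq: "isCont (\<lambda>z. sq_length T (l z) t X Y) z0" if "X \<in> verts T t" "Y \<in> verts T t" "X \<noteq> Y" for X Y
    using dsq[OF that] DERIV_isCont by blast
  have cs: "isCont (\<lambda>z. sq_length T (l z) t A B) z0" "isCont (\<lambda>z. sq_length T (l z) t A C) z0"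
    "isCont (\<lambda>z. sq_length T (l z) t A D) z0" "isCont (\<lambda>z. sq_length T (l z) t B C) z0"
    "isCont (\<lambda>z. sq_length T (l z) t B D) z0" "isCont (\<lambda>z. sq_length T (l z) t C D) z0"
    using dis v by (auto intro!: csq)
  have "\<forall>\<^sub>F z in nhds z0. nondegenerate_at T (l z) t A B C D"
    unfolding nondegenerate_at_def eventually_conj_iff
  proof (intro conjI)
    show "\<forall>\<^sub>F z in nhds z0. \<forall>X \<in> {A, B, C, D}. \<forall>Y \<in> {A, B, C, D}. X \<noteq> Y \<longrightarrow> 0 < l z (edge_between T t X Y)"
    proof (intro eventually_ball_finite ballI)
      fix X Y assume XY: "X \<in> {A, B, C, D}" "Y \<in> {A, B, C, D}"
      show "\<forall>\<^sub>F z in nhds z0. X \<noteq> Y \<longrightarrow> 0 < l z (edge_between T t X Y)"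
      proof (cases "X = Y")
        case False
        then have "\<forall>\<^sub>F z in nhds z0. 0 < l z (edge_between T t X Y)"
          using nd XY v l0 by (intro ev ce) (auto simp: nondegenerate_at_def)
        then show ?thesis by (rule eventually_mono) simp
      qed simp
    qed auto
    have cont: "isCont (\<lambda>z. face_gram (sq_length T (l z) t A B) (sq_length T (l z) t A C) (sq_length T (l z) t B C)) z0"
      "isCont (\<lambda>z. face_gram (sq_length T (l z) t A B) (sq_length T (l z) t A D) (sq_length T (l z) t B D)) z0"
      "isCont (\<lambda>z. tet_gram (sq_length T (l z) t A B) (sq_length T (l z) t A C) (sq_length T (l z) t A D)
        (sq_length T (l z) t B C) (sq_length T (l z) t B D) (sq_length T (l z) t C D)) z0"
      unfolding face_gram_def tet_gram_def by (intro continuous_intros cs; simp)+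
    show "\<forall>\<^sub>F z in nhds z0. 0 < face_gram (sq_length T (l z) t A B) (sq_length T (l z) t A C)
        (sq_length T (l z) t B C)"
      by (rule ev[OF cont(1)]) (use nd in \<open>simp add: l0 nondegenerate_at_def\<close>)
    show "\<forall>\<^sub>F z in nhds z0. 0 < face_gram (sq_length T (l z) t A B) (sq_length T (l z) t A D)
        (sq_length T (l z) t B D)"
      by (rule ev[OF cont(2)]) (use nd in \<open>simp add: l0 nondegenerate_at_def\<close>)
    show "\<forall>\<^sub>F z in nhds z0. 0 < tet_gram (sq_length T (l z) t A B) (sq_length T (l z) t A C)
        (sq_length T (l z) t A D) (sq_length T (l z) t B C) (sq_length T (l z) t B D) (sq_length T (l z) t C D)"
      by (rule ev[OF cont(3)]) (use nd in \<open>simp add: l0 nondegenerate_at_def\<close>)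
  qed
  then have "\<forall>\<^sub>F z in nhds z0. dihedral_of_lengths T (l z) t (edge_between T t A B) = dihedral_at T (l z) t A B C D"
    by (rule eventually_mono) (rule dihedral_of_lengths_eq[OF t v])
  then show "((\<lambda>z. dihedral_of_lengths T (l z) t (edge_between T t A B)) has_real_derivative
      dihedral_diff_at T L t A B C D m) (at z0)"
    using f by (subst DERIV_cong_ev[OF refl _ refl]) auto
qed

section \<open>The matrix of partial derivatives of the angles\<close>

definition angle_partial :: "'c \<Rightarrow> 'c \<Rightarrow> 'c \<Rightarrow> real" where
  "angle_partial t i j = deriv (\<lambda>s. dihedral_of_lengths T (L(j := s)) t i) (L j)"

lemma angle_partial_has_derivative:
  assumes "t \<in> tetrahedra T" "verts T t = {A, B, C, D}"
  shows "((\<lambda>s. dihedral_of_lengths T (L(j := s)) t (edge_between T t A B)) has_real_derivative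
    angle_partial t (edge_between T t A B) j) (at (L j))"
    and "angle_partial t (edge_between T t A B) j =
      dihedral_diff_at T L t A B C D (\<lambda>e. if e = j then 1 else 0)"
proof -
  have d: "((\<lambda>s. (L(j := s)) e) has_real_derivative (if e = j then 1 else 0)) (at (L j))" for e
    by (cases "e = j") (auto intro!: derivative_eq_intros)
  have "L(j := L j) = L" by simp
  from dihedral_of_lengths_has_derivative(2)[of t A B C D "\<lambda>s. L(j := s)", OF assms d this]
  show "((\<lambda>s. dihedral_of_lengths T (L(j := s)) t (edge_between T t A B)) has_real_derivative
    angle_partial t (edge_between T t A B) j) (at (L j))"
    and "angle_partial t (edge_between T t A B) j =
      dihedral_diff_at T L t A B C D (\<lambda>e. if e = j then 1 else 0)"
    unfolding angle_partial_def by (auto simp: DERIV_imp_deriv)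
qed

lemma six_edges_distinct:
  assumes "t \<in> tetrahedra T" "verts T t = {A, B, C, D}"
  shows "distinct [edge_between T t A B, edge_between T t A C, edge_between T t A D,
      edge_between T t B C, edge_between T t B D, edge_between T t C D]"
  using tetrahedron_distinct[OF assms] assms(2)
  by (simp add: edge_between_inj[OF assms(1)] doubleton_eq_iff)

text \<open>
  The chain rule for the dihedral angle at \<open>AB\<close>.
\<close>

lemma sum_angle_partial:
  assumes t: "t \<in> tetrahedra T" and v: "verts T t = {A, B, C, D}"
  shows "(\<Sum>j \<in> {e \<in> edges T. is_face T e t}. angle_partial t (edge_between T t A B) j * m j)
    = dihedral_diff_at T L t A B C D m"
proof -
  let ?d = "dihedral_diff (sq_length T L t A B) (sq_length T L t A C) (sq_length T L t A D)
    (sq_length T L t B C) (sq_length T L t B D) (sq_length T L t C D)"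
  let ?E = "{e \<in> edges T. is_face T e t}"
  have pick: "(\<Sum>j\<in>?E. a * (if e = j then 1 else 0) * c * m j) = a * m e * c" if "e \<in> ?E" for a c e
  proof -
    have "(\<Sum>j\<in>?E. a * (if e = j then 1 else 0) * c * m j) = (\<Sum>j\<in>?E. if e = j then a * m e * c else 0)"
      by (intro sum.cong) auto
    then show ?thesis using that finite_edges by simp
  qed
  have E: "edge_between T t A B \<in> ?E" "edge_between T t A C \<in> ?E" "edge_between T t A D \<in> ?E"
    "edge_between T t B C \<in> ?E" "edge_between T t B D \<in> ?E" "edge_between T t C D \<in> ?E"
    unfolding tetrahedron_edges[OF t v] by simp_all
  have lin: "dihedral_diff_at T L t A B C D g =
      2 * L (edge_between T t A B) * g (edge_between T t A B) * ?d 1 0 0 0 0 0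
    + 2 * L (edge_between T t A C) * g (edge_between T t A C) * ?d 0 1 0 0 0 0
    + 2 * L (edge_between T t A D) * g (edge_between T t A D) * ?d 0 0 1 0 0 0
    + 2 * L (edge_between T t B C) * g (edge_between T t B C) * ?d 0 0 0 1 0 0
    + 2 * L (edge_between T t B D) * g (edge_between T t B D) * ?d 0 0 0 0 1 0
    + 2 * L (edge_between T t C D) * g (edge_between T t C D) * ?d 0 0 0 0 0 1" for g
    unfolding dihedral_diff_at_def Let_def by (rule dihedral_diff_linear)
  show ?thesis
    unfolding angle_partial_has_derivative(2)[OF t v] lin distrib_right sum.distrib
      pick[OF E(1)] pick[OF E(2)] pick[OF E(3)] pick[OF E(4)] pick[OF E(5)] pick[OF E(6)] ..
qed

lemma angle_partial_nonface:
  assumes t: "t \<in> tetrahedra T" and i: "is_face T i t" "i \<in> edges T" and j: "\<not> is_face T j t"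
  shows "angle_partial t i j = 0"
proof -
  obtain A B where AB: "verts T i = {A, B}" "A \<noteq> B" using edge_verts[OF i(2)] by blast
  obtain C D where v: "verts T t = {A, B, C, D}" using tetrahedron_labels[OF t i(1) AB] by blast
  have "edge_between T t X Y \<noteq> j" if "X \<in> verts T t" "Y \<in> verts T t" "X \<noteq> Y" for X Y
    using edge_between(1)[OF t that] j by blast
  then have "dihedral_diff_at T L t A B C D (\<lambda>e. if e = j then 1 else 0) = 0"
    using tetrahedron_distinct[OF t v] v
    by (simp add: dihedral_diff_at_def dihedral_diff_def)
  then show ?thesis
    using angle_partial_has_derivative(2)[OF t v] edge_between_eqI[OF i(1) AB(1)] by simp
qed

text \<open>
  Two distinct edges of a tetrahedron are adjacent or opposite, which reduces the claim to
  \<open>dihedral_diff_adjacent_symmetric\<close> and \<open>dihedral_diff_opposite_symmetric\<close> after relabelling.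
\<close>

lemma angle_partial_symmetric:
  assumes t: "t \<in> tetrahedra T" and i: "is_face T i t" "i \<in> edges T" and j: "is_face T j t" "j \<in> edges T"
  shows "angle_partial t i j = angle_partial t j i"
proof -
  have adjacent: "angle_partial t (edge_between T t A B) (edge_between T t A C)
      = angle_partial t (edge_between T t A C) (edge_between T t A B)"
    if v: "verts T t = {A, B, C, D}" for A B C D
  proof -
    have v': "verts T t = {A, C, B, D}" using v by auto
    have nd: "nondegenerate_at T L t A B C D" using nondegenerate_unperturbed[OF t v] .
    then have "L (edge_between T t A B) > 0" "L (edge_between T t A C) > 0"
      "face_gram ((L (edge_between T t A B))\<^sup>2) ((L (edge_between T t A C))\<^sup>2) (sq_length T L t B C) > 0"
      using tetrahedron_distinct[OF t v] unfolding nondegenerate_at_def by (auto simp: sq_length_def)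
    note s = dihedral_diff_adjacent_symmetric[OF this]
    show ?thesis
      unfolding angle_partial_has_derivative(2)[OF t v] angle_partial_has_derivative(2)[OF t v']
        dihedral_diff_at_def Let_def
      using six_edges_distinct[OF t v] six_edges_distinct[OF t v'] s[of "sq_length T L t A D" "sq_length T L t B D" "sq_length T L t C D"]
      by (auto simp: sq_length_def edge_between_commute[of T t C B] edge_between_commute[of T t D])
  qed
  have opposite: "angle_partial t (edge_between T t A B) (edge_between T t C D)
      = angle_partial t (edge_between T t C D) (edge_between T t A B)"
    if v: "verts T t = {A, B, C, D}" for A B C D
  proof -
    have v': "verts T t = {C, D, A, B}" using v by auto
    have nd: "nondegenerate_at T L t A B C D" using nondegenerate_unperturbed[OF t v] .
    then have "L (edge_between T t A B) > 0" "L (edge_between T t C D) > 0"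
      using tetrahedron_distinct[OF t v] unfolding nondegenerate_at_def by auto
    note s = dihedral_diff_opposite_symmetric[OF this]
    show ?thesis
      unfolding angle_partial_has_derivative(2)[OF t v] angle_partial_has_derivative(2)[OF t v']
        dihedral_diff_at_def Let_def
      using six_edges_distinct[OF t v] six_edges_distinct[OF t v']
        s[of "sq_length T L t A C" "sq_length T L t A D" "sq_length T L t B C" "sq_length T L t B D"]
      by (auto simp: sq_length_def edge_between_commute[of T t C A] edge_between_commute[of T t C B]
          edge_between_commute[of T t D A] edge_between_commute[of T t D B])
  qed
  obtain A B where AB: "verts T i = {A, B}" "A \<noteq> B" using edge_verts[OF i(2)] by blast
  obtain C D where v: "verts T t = {A, B, C, D}" using tetrahedron_labels[OF t i(1) AB] by blast
  obtain X Y where XY: "verts T j = {X, Y}" "X \<noteq> Y" using edge_verts[OF j(2)] by blast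
  have ij: "i = edge_between T t A B" "j = edge_between T t X Y"
    using edge_between_eqI i(1) AB(1) j(1) XY(1) by metis+
  have "X \<in> {A, B, C, D}" "Y \<in> {A, B, C, D}" using face_verts[OF j(1)] XY v by auto
  moreover have "verts T t = {A, B, D, C}" "verts T t = {B, A, C, D}" "verts T t = {B, A, D, C}"
    using v by auto
  ultimately show ?thesis
    unfolding ij using \<open>X \<noteq> Y\<close> adjacent[OF v] adjacent[of A B D C] adjacent[of B A C D] adjacent[of B A D C]
      opposite[OF v]
    by (elim insertE emptyE)
      (simp_all add: edge_between_commute[of T t B A] edge_between_commute[of T t C A]
          edge_between_commute[of T t D A] edge_between_commute[of T t C B]
          edge_between_commute[of T t D B] edge_between_commute[of T t D C])
qed

definition tets_at :: "'c \<Rightarrow> 'c set" where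
  "tets_at i = {t \<in> tetrahedra T. is_face T i t}"

lemma finite_tets_at: "finite (tets_at i)"
  using finite_tetrahedra by (simp add: tets_at_def)

lemma F3_eq:
  assumes i: "i \<in> edges T"
  shows "F3 T M orn x i j =
    - (\<Sum>t \<in> tets_at i. sgn (oriented_volume T orn x t) * angle_partial t i j)"
proof -
  obtain A B where AB: "verts T i = {A, B}" "A \<noteq> B" using edge_verts[OF i] by blast
  have "((\<lambda>s. dihedral_of_lengths T (L(j := s)) t i) has_real_derivative angle_partial t i j) (at (L j))"
    if "t \<in> tets_at i" for t
  proof -
    have t: "t \<in> tetrahedra T" "is_face T i t" using that by (auto simp: tets_at_def)
    obtain C D where v: "verts T t = {A, B, C, D}" using tetrahedron_labels[OF t AB] by blast
    show ?thesis using angle_partial_has_derivative(1)[OF t(1) v] edge_between_eqI[OF t(2) AB(1)] by simp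
  qed
  then have "((\<lambda>s. signed_angle_sum T orn x (L(j := s)) i) has_real_derivative
      (\<Sum>t \<in> tets_at i. sgn (oriented_volume T orn x t) * angle_partial t i j)) (at (L j))"
    unfolding signed_angle_sum_def tets_at_def[symmetric]
    by (intro DERIV_sum DERIV_cmult)
  then have "((\<lambda>s. omega_alpha T M orn x (L(j := s)) i) has_real_derivative
      - (\<Sum>t \<in> tets_at i. sgn (oriented_volume T orn x t) * angle_partial t i j)) (at (L j))"
    unfolding omega_alpha_def
    by (cases "i \<in> inner_edges T M") (auto intro!: derivative_eq_intros)
  then show ?thesis unfolding F3_def by (rule DERIV_imp_deriv)
qed

lemma F3_symmetric:
  assumes i: "i \<in> edges T" and j: "j \<in> edges T"
  shows "F3 T M orn x i j = F3 T M orn x j i"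
proof -
  have *: "(\<Sum>t \<in> tets_at i. sgn (oriented_volume T orn x t) * angle_partial t i j)
    = (\<Sum>t \<in> tets_at i \<inter> tets_at j. sgn (oriented_volume T orn x t) * angle_partial t i j)"
    if "i \<in> edges T" for i j
    using finite_tets_at that by (intro sum.mono_neutral_right) (auto simp: tets_at_def angle_partial_nonface)
  have "(\<Sum>t \<in> tets_at i. sgn (oriented_volume T orn x t) * angle_partial t i j)
      = (\<Sum>t \<in> tets_at j. sgn (oriented_volume T orn x t) * angle_partial t j i)"
    unfolding *[OF i, of j] *[OF j, of i]
    using i j angle_partial_symmetric by (intro sum.cong) (auto simp: tets_at_def)
  then show ?thesis using F3_eq i j by simp
qed

section \<open>Lengths and angles under motions of the vertices\<close>

definition length_rate :: "('v \<Rightarrow> real ^ 3) \<Rightarrow> 'c \<Rightarrow> real" where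
  "length_rate V i = deriv (\<lambda>s. edge_length T (\<lambda>A. x A + s *\<^sub>R V A) i) 0"

lemma F2_eq_length_rate: "F2 T x i q = length_rate (velocity T x q) i"
  by (simp add: F2_def length_rate_def)

lemma dist_has_derivative:
  fixes a b a' b' :: "real ^ 3"
  assumes "a \<noteq> b"
  shows "((\<lambda>s. dist (a + s *\<^sub>R a') (b + s *\<^sub>R b')) has_real_derivative
    ((a - b) \<bullet> (a' - b')) / dist a b) (at 0)"
proof -
  define w w' where w: "w = a - b" "w' = a' - b'"
  have "(a + s *\<^sub>R a') - (b + s *\<^sub>R b') = w + s *\<^sub>R w'" for s
    by (simp add: w algebra_simps)
  moreover have "(w + s *\<^sub>R w') \<bullet> (w + s *\<^sub>R w') = w \<bullet> w + 2 * s * (w \<bullet> w') + s\<^sup>2 * (w' \<bullet> w')" for s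
    by (simp only: inner_add_left inner_add_right inner_scaleR_left inner_scaleR_right inner_commute[of w' w])
       (simp add: algebra_simps power2_eq_square)
  ultimately have e: "dist (a + s *\<^sub>R a') (b + s *\<^sub>R b')
      = sqrt (w \<bullet> w + 2 * s * (w \<bullet> w') + s\<^sup>2 * (w' \<bullet> w'))" for s
    by (simp only: dist_norm norm_eq_sqrt_inner)
  have pos: "w \<bullet> w > 0" using assms by (simp add: w)
  have "((\<lambda>s. w \<bullet> w + 2 * s * (w \<bullet> w') + s\<^sup>2 * (w' \<bullet> w')) has_real_derivative 2 * (w \<bullet> w')) (at 0)"
    by (auto intro!: derivative_eq_intros)
  from DERIV_chain2[OF DERIV_real_sqrt this] pos
  have sqrt: "((\<lambda>s. sqrt (w \<bullet> w + 2 * s * (w \<bullet> w') + s\<^sup>2 * (w' \<bullet> w'))) has_real_derivative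
      inverse (sqrt (w \<bullet> w)) / 2 * (2 * (w \<bullet> w'))) (at 0)" by simp
  have val: "inverse (sqrt (w \<bullet> w)) / 2 * (2 * (w \<bullet> w')) = ((a - b) \<bullet> (a' - b')) / dist a b"
    unfolding dist_norm norm_eq_sqrt_inner w[symmetric] by (simp only: divide_inverse) simp
  show ?thesis using sqrt unfolding e val .
qed

lemma length_rate_has_derivative:
  assumes "i \<in> edges T" "verts T i = {A, B}"
  shows "length_rate V i = ((x A - x B) \<bullet> (V A - V B)) / dist (x A) (x B)"
    and "((\<lambda>s. edge_length T (\<lambda>A. x A + s *\<^sub>R V A) i) has_real_derivative length_rate V i) (at 0)"
proof -
  have d: "((\<lambda>s. edge_length T (\<lambda>A. x A + s *\<^sub>R V A) i) has_real_derivative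
      ((x A - x B) \<bullet> (V A - V B)) / dist (x A) (x B)) (at 0)"
    unfolding edge_length_eq[OF assms(2)]
    by (rule dist_has_derivative[OF edge_ends_distinct[OF assms]])
  then show l: "length_rate V i = ((x A - x B) \<bullet> (V A - V B)) / dist (x A) (x B)"
    unfolding length_rate_def by (rule DERIV_imp_deriv)
  show "((\<lambda>s. edge_length T (\<lambda>A. x A + s *\<^sub>R V A) i) has_real_derivative length_rate V i) (at 0)"
    using d unfolding l .
qed

definition half_plane_rate :: "('v \<Rightarrow> real ^ 3) \<Rightarrow> 'v \<Rightarrow> 'v \<Rightarrow> 'v \<Rightarrow> real" where
  "half_plane_rate V A B X = face_rate (x B - x A) (x X - x A) (V B - V A) (V X - V A)"

text \<open>
  The derivative of the dihedral angle along the motion is computed twice: through the edge lengths, by the chain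
  rule, and directly. The sign of the determinant that appears in the direct formula
  cancels against the one in the sign of the oriented volume, and the orientation remains.
\<close>

lemma angle_rate_of_motion:
  assumes t: "t \<in> tetrahedra T" and v: "verts T t = {A, B, C, D}"
  shows "sgn (oriented_volume T orn x t) *
      (\<Sum>j \<in> {e \<in> edges T. is_face T e t}. angle_partial t (edge_between T t A B) j * length_rate V j)
    = of_int (orn t [A, B, C, D]) * (half_plane_rate V A B D - half_plane_rate V A B C)"
proof -
  define y where "y s = (\<lambda>A. x A + s *\<^sub>R V A)" for s
  have d: "((\<lambda>s. edge_length T (y s) e) has_real_derivative length_rate V e) (at 0)"
    if e: "e \<in> edges T" for e
  proof -
    obtain X Y where "verts T e = {X, Y}" using edge_verts[OF e] by blast
    then show ?thesis unfolding y_def by (rule length_rate_has_derivative(2)[OF e])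
  qed
  have y0: "edge_length T (y 0) = L" by (simp add: y_def)
  have 1: "((\<lambda>s. dihedral_at T (edge_length T (y s)) t A B C D) has_real_derivative
      dihedral_diff_at T L t A B C D (length_rate V)) (at 0)"
    using dihedral_of_lengths_has_derivative(1)[of t A B C D "\<lambda>s. edge_length T (y s)" "length_rate V" 0]
      t v d y0 by blast
  have gen: "(f \<longlongrightarrow> f 0) (nhds 0)" if "isCont f 0" for f :: "real \<Rightarrow> real"
    using that by (simp add: isCont_def tendsto_at_iff_tendsto_nhds)
  have "isCont (\<lambda>s. dist (y s A) (y s B)) 0" unfolding y_def by (intro continuous_intros)
  then have "((\<lambda>s. dist (y s A) (y s B)) \<longlongrightarrow> dist (x A) (x B)) (nhds 0)"
    using gen[of "\<lambda>s. dist (y s A) (y s B)"] by (simp add: y_def)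
  then have "\<forall>\<^sub>F s in nhds 0. dist (y s A) (y s B) > 0"
    using edge_points_distinct[OF t v] by (intro order_tendstoD(1)) auto
  then have "\<forall>\<^sub>F s in nhds 0. dihedral_at T (edge_length T (y s)) t A B C D
      = dihedral_angle (y s A) (y s B) (y s C) (y s D)"
    by (rule eventually_mono)
       (auto intro!: dihedral_angle_realized[OF t v, symmetric] simp: realizes_lengths_def)
  with 1 have 2: "((\<lambda>s. dihedral_angle (y s A) (y s B) (y s C) (y s D)) has_real_derivative
      dihedral_diff_at T L t A B C D (length_rate V)) (at 0)"
    by (subst (asm) DERIV_cong_ev[OF refl _ refl]) auto
  have "dihedral_diff_at T L t A B C D (length_rate V) = sgn (vdet A B C D) * (half_plane_rate V A B D - half_plane_rate V A B C)"
    using DERIV_unique[OF 2] dihedral_angle_has_derivative[OF vdet_nonzero[OF t v], of "V A" "V B" "V C" "V D"]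
    unfolding y_def half_plane_rate_def by blast
  moreover have "sgn (vdet A B C D) * sgn (vdet A B C D) = 1"
    using vdet_nonzero[OF t v] by (simp add: sgn_if)
  ultimately show ?thesis
    unfolding sum_angle_partial[OF t v] sgn_volume[OF t v] by simp
qed

section \<open>Stationary angle sums\<close>

text \<open>
  What the sways and the displacements of inner vertices have in common on the boundary.
\<close>

definition boundary_rigid :: "('v \<Rightarrow> real ^ 3) \<Rightarrow> bool" where
  "boundary_rigid V \<longleftrightarrow>
     (\<forall>c \<in> bdry_components M. \<exists>b \<omega>. \<forall>Z. vertex_in T Z c \<longrightarrow> V Z = b + \<omega> \<times> x Z)"

lemma rigid_diff: "(b + \<omega> \<times> y) - (b + \<omega> \<times> z) = \<omega> \<times> (y - z)" for b \<omega> y z :: "real ^ 3"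
  by (simp add: Cross3.right_diff_distrib)

lemma boundary_edge_length_rate:
  assumes V: "boundary_rigid V" and i: "i \<in> bdry_edges T M"
  shows "length_rate V i = 0"
proof -
  have i': "i \<in> edges T" "i \<in> cells T" "cell_set T i \<subseteq> bdry M"
    using i by (auto simp: bdry_edges_def edges_def)
  obtain c where c: "c \<in> bdry_components M" "cell_set T i \<subseteq> c" using cell_in_bdry_component i' by blast
  obtain A B where AB: "verts T i = {A, B}" using edge_verts[OF i'(1)] by blast
  have "vertex_in T A c" "vertex_in T B c" using vertex_in_if_cell[OF i'(2) _ c(2)] AB by auto
  then obtain b \<omega> where "V A = b + \<omega> \<times> x A" "V B = b + \<omega> \<times> x B"
    using V c(1) unfolding boundary_rigid_def by metis
  then show ?thesis
    unfolding length_rate_has_derivative(1)[OF i'(1) AB] by (simp only: rigid_diff dot_cross_self div_0)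
qed

text \<open>
  The boundary triangles at an edge contain its end \<open>A\<close>, so they all lie in the boundary component of \<open>A\<close>
  and move by a single infinitesimal isometry. If \<open>A\<close> lies on no component, there are no such triangles.
\<close>

lemma boundary_faces_rotate_together:
  assumes V: "boundary_rigid V" and i: "i \<in> edges T" "verts T i = {A, B}"
  shows "\<exists>\<rho>. \<forall>f X t. is_face T i f \<and> is_face T f t \<and> t \<in> tetrahedra T \<and> cell_set T f \<subseteq> bdry M
    \<and> verts T f = {A, B, X} \<and> X \<notin> {A, B} \<longrightarrow> half_plane_rate V A B X = \<rho>"
proof (cases "\<exists>c \<in> bdry_components M. vertex_in T A c")
  case False
  then show ?thesis
    using cell_in_bdry_component vertex_in_if_cell face_cells by (metis insertI1)
next
  case True
  then obtain c where c: "c \<in> bdry_components M" "vertex_in T A c" by blast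
  then obtain b \<omega> where rig: "\<And>Z. vertex_in T Z c \<Longrightarrow> V Z = b + \<omega> \<times> x Z"
    using V unfolding boundary_rigid_def by metis
  have "half_plane_rate V A B X = ((x B - x A) \<bullet> \<omega>) / norm (x B - x A)"
    if f: "is_face T i f" "is_face T f t" "t \<in> tetrahedra T" "cell_set T f \<subseteq> bdry M"
      "verts T f = {A, B, X}" "X \<notin> {A, B}" for f X t
  proof -
    obtain c' where c': "c' \<in> bdry_components M" "cell_set T f \<subseteq> c'"
      using cell_in_bdry_component face_cells f by blast
    have vc: "vertex_in T A c'" "vertex_in T B c'" "vertex_in T X c'"
      using vertex_in_if_cell[OF face_cells(1)[OF f(2)] _ c'(2)] f(5) by auto
    then have "c' = c" using vertex_component_unique c c' by blast
    then have "V A = b + \<omega> \<times> x A" "V B = b + \<omega> \<times> x B" "V X = b + \<omega> \<times> x X" using rig vc by auto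
    then have r: "half_plane_rate V A B X = face_rate (x B - x A) (x X - x A) (\<omega> \<times> (x B - x A)) (\<omega> \<times> (x X - x A))"
      unfolding half_plane_rate_def by (simp only: rigid_diff)
    have "A \<noteq> B" using i by (auto simp: edges_def)
    then obtain C D where v: "verts T t = {A, B, C, D}"
      using tetrahedron_labels[OF f(3) face_trans[OF f(1,2)] i(2)] by blast
    then have "X = C \<or> X = D" using face_verts[OF f(2)] f(5,6) by auto
    then obtain Y where vX: "verts T t = {A, B, X, Y}" using v by blast
    have u: "x B - x A \<noteq> 0" using edge_ends_distinct[OF i] by simp
    have "perp_part (x B - x A) (x X - x A) \<noteq> 0"
      using perp_part_cross[OF u, of "x X - x A" "x Y - x A"] vdet_nonzero[OF f(3) vX] u by auto
    then show ?thesis unfolding r using face_rate_rotation u by blast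
  qed
  then show ?thesis by blast
qed

text \<open>
  The double sum over the tetrahedra at the edge and their two faces there is rearranged into a sum over
  triangles. For a tetrahedron \<open>t\<close> and a face \<open>f\<close> at the edge \<open>AB\<close>, \<open>apex f\<close> is the third vertex of the face,
  \<open>far t f\<close> the remaining vertex of \<open>t\<close>, and \<open>\<epsilon> t f\<close> the sign with which the speed of
  \<open>f\<close> enters, up to a sign common to all terms. The speeds are measured relative to \<open>\<rho>\<close>, the common speed of the boundary triangles.
\<close>

lemma signed_angle_sum_stationary:
  assumes V: "boundary_rigid V" and i: "i \<in> edges T"
  shows "(\<Sum>t \<in> tets_at i. sgn (oriented_volume T orn x t) *
    (\<Sum>j \<in> {e \<in> edges T. is_face T e t}. angle_partial t i j * length_rate V j)) = 0"
proof -
  obtain A B where AB: "verts T i = {A, B}" "A \<noteq> B" using edge_verts[OF i] by blast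
  obtain \<rho> where \<rho>: "\<And>f X t. is_face T i f \<Longrightarrow> is_face T f t \<Longrightarrow> t \<in> tetrahedra T \<Longrightarrow>
      cell_set T f \<subseteq> bdry M \<Longrightarrow> verts T f = {A, B, X} \<Longrightarrow> X \<notin> {A, B} \<Longrightarrow> half_plane_rate V A B X = \<rho>"
    using boundary_faces_rotate_together[OF V i AB(1)] by metis
  define tris where "tris = {f \<in> cells T. card (verts T f) = 3 \<and> is_face T i f}"
  define apex where "apex f = the_elem (verts T f - {A, B})" for f
  define far where "far t f = the_elem (verts T t - verts T f)" for t f
  define h where "h f = half_plane_rate V A B (apex f) - \<rho>" for f
  define \<epsilon> :: "'c \<Rightarrow> 'c \<Rightarrow> real" where "\<epsilon> t f = of_int (orn t [A, B, apex f, far t f])" for t f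
  have fin: "finite tris" using finite_cells by (rule rev_finite_subset) (auto simp: tris_def)
  have tri: "verts T f = {A, B, apex f}" "apex f \<notin> {A, B}" if "f \<in> tris" for f
  proof -
    have "card (verts T f - {A, B}) = 1"
      using that AB face_verts[of i f] finite_verts by (subst card_Diff_subset) (auto simp: tris_def)
    then obtain X where X: "verts T f - {A, B} = {X}" by (auto simp: card_1_singleton_iff)
    then have "apex f = X" by (simp add: apex_def)
    moreover have "{A, B} \<subseteq> verts T f" using that AB face_verts[of i f] by (auto simp: tris_def)
    ultimately show "verts T f = {A, B, apex f}" "apex f \<notin> {A, B}" using X by auto
  qed
  have tet: "verts T t = {A, B, apex f, far t f}" if "f \<in> tris" "t \<in> tetrahedra T" "is_face T f t" for f t
  proof -
    have "card (verts T t - verts T f) = 1"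
      using that face_verts[of f t] finite_verts by (subst card_Diff_subset) (auto simp: tris_def tetrahedra_def)
    then obtain Y where Y: "verts T t - verts T f = {Y}" by (auto simp: card_1_singleton_iff)
    then have "far t f = Y" by (simp add: far_def)
    then show ?thesis using Y face_verts[OF that(3)] tri[OF that(1)] by auto
  qed
  have per_tet: "sgn (oriented_volume T orn x t) *
      (\<Sum>j \<in> {e \<in> edges T. is_face T e t}. angle_partial t i j * length_rate V j)
    = - (\<Sum>f | f \<in> tris \<and> is_face T f t. \<epsilon> t f * h f)" if "t \<in> tets_at i" for t
  proof -
    have t: "t \<in> tetrahedra T" "is_face T i t" using that by (auto simp: tets_at_def)
    obtain C D where v: "verts T t = {A, B, C, D}" using tetrahedron_labels[OF t AB] by blast
    have dis: "distinct [A, B, C, D]" using tetrahedron_distinct[OF t(1) v] .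
    have face: "\<exists>f. f \<in> tris \<and> is_face T f t \<and> verts T f = {A, B, X}" if X: "X \<in> {C, D}" for X
    proof -
      obtain f where f: "is_face T f t" "verts T f = {A, B, X}"
        using face_exists[OF tet_cells[OF t(1)], of "{A, B, X}"] v X by auto
      have "is_face T i f" using face_of_common[OF t(2) f(1)] f(2) AB by auto
      moreover have "card {A, B, X} = 3" using X dis by auto
      ultimately show ?thesis using f face_cells(1)[OF f(1)] unfolding tris_def by auto
    qed
    obtain fC where fC: "fC \<in> tris" "is_face T fC t" "verts T fC = {A, B, C}"
      using face[of C] by blast
    obtain fD where fD: "fD \<in> tris" "is_face T fD t" "verts T fD = {A, B, D}"
      using face[of D] by blast
    have "f = fC \<or> f = fD" if f: "f \<in> tris" "is_face T f t" for f
    proof -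
      have "apex f = C \<or> apex f = D" using tri[OF f(1)] face_verts[OF f(2)] v by auto
      then show ?thesis using tri(1)[OF f(1)] face_unique[OF f(2)] fC fD by metis
    qed
    then have faces: "{f. f \<in> tris \<and> is_face T f t} = {fC, fD}" using fC fD by blast
    have ne: "fC \<noteq> fD" using fC fD dis by auto
    have ap: "apex fC = C" "apex fD = D" using fC fD dis by (auto simp: apex_def insert_Diff_if)
    have fr: "far t fC = D" "far t fD = C" using fC fD v dis by (auto simp: far_def insert_Diff_if)
    have "(\<Sum>f | f \<in> tris \<and> is_face T f t. \<epsilon> t f * h f)
        = of_int (orn t [A, B, C, D]) * (half_plane_rate V A B C - half_plane_rate V A B D)"
      unfolding faces using ne
      by (simp add: \<epsilon>_def h_def ap fr orn_swaps(3)[OF t(1) v] algebra_simps)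
    then show ?thesis
      using angle_rate_of_motion[OF t(1) v, of V] edge_between_eqI[OF t(2) AB(1)]
      by (simp add: algebra_simps)
  qed
  have per_tri: "(\<Sum>t | t \<in> tets_at i \<and> is_face T f t. \<epsilon> t f * h f) = 0" if f: "f \<in> tris" for f
  proof -
    let ?N = "{t. t \<in> tets_at i \<and> is_face T f t}"
    have N: "t \<in> ?N \<longleftrightarrow> t \<in> tetrahedra T \<and> is_face T f t" for t
      using f face_trans unfolding tets_at_def tris_def by blast
    \<comment> \<open>Coherence of the orientation across the triangle.\<close>
    have opp: "\<epsilon> t f = - \<epsilon> t' f" if "t \<in> ?N" "t' \<in> ?N" "t \<noteq> t'" for t t'
    proof -
      have "orn t [A, B, apex f, far t f] = - orn t' [A, B, apex f, far t' f]"
        using orients that f tri[OF f] tet[OF f, of t] tet[OF f, of t'] N[of t] N[of t']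
        unfolding orients_def tris_def by blast
      then show ?thesis by (simp add: \<epsilon>_def)
    qed
    have nz: "\<epsilon> t f \<noteq> 0" if "t \<in> ?N" for t
    proof -
      have "t \<in> tetrahedra T" "is_face T f t" using that N by blast+
      then show ?thesis using orn_values[OF _ tet[OF f]] by (force simp: \<epsilon>_def)
    qed
    consider "?N = {}" | t where "?N = {t}" | t t' where "t \<in> ?N" "t' \<in> ?N" "t \<noteq> t'" by blast
    then show ?thesis
    proof cases
      case 1
      then show ?thesis by (simp only: sum.empty)
    next
      case (2 t)
      then have t: "t \<in> tetrahedra T" "is_face T f t" using N by blast+
      have uniq: "t' = t" if "t' \<in> tetrahedra T" "is_face T f t'" for t' using that 2 N by blast
      have "cell_set T f \<subseteq> bdry M"
        using free_triangle_in_bdry[OF _ _ t uniq] f by (auto simp: tris_def)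
      then have "h f = 0" using \<rho>[OF _ t(2,1), of "apex f"] tri[OF f] f by (auto simp: h_def tris_def)
      then show ?thesis by simp
    next
      case (3 t t')
      \<comment> \<open>Of three tetrahedra at a triangle, two would have equal signs.\<close>
      have "s = t \<or> s = t'" if "s \<in> ?N" for s
        using opp[OF that 3(1)] opp[OF that 3(2)] opp[OF 3] nz[OF 3(1)] by linarith
      then have "?N = {t, t'}" using 3 by blast
      then show ?thesis using opp[OF 3] 3(3) by simp
    qed
  qed
  have "(\<Sum>t \<in> tets_at i. sgn (oriented_volume T orn x t) *
    (\<Sum>j \<in> {e \<in> edges T. is_face T e t}. angle_partial t i j * length_rate V j))
    = - (\<Sum>t \<in> tets_at i. \<Sum>f | f \<in> tris \<and> is_face T f t. \<epsilon> t f * h f)"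
    using per_tet by (simp add: sum_negf)
  also have "\<dots> = - (\<Sum>f \<in> tris. \<Sum>t | t \<in> tets_at i \<and> is_face T f t. \<epsilon> t f * h f)"
    using sum.swap_restrict[OF finite_tets_at fin, of "\<lambda>t f. \<epsilon> t f * h f" "\<lambda>t f. is_face T f t"] by simp
  also have "\<dots> = 0" using per_tri by simp
  finally show ?thesis .
qed

lemma F3_length_rate:
  assumes V: "boundary_rigid V" and i: "i \<in> edges T"
  shows "(\<Sum>j \<in> edges T. F3 T M orn x i j * length_rate V j) = 0"
proof -
  have "(\<Sum>j \<in> edges T. F3 T M orn x i j * length_rate V j)
    = - (\<Sum>j \<in> edges T. \<Sum>t \<in> tets_at i. sgn (oriented_volume T orn x t) * (angle_partial t i j * length_rate V j))"
    unfolding F3_eq[OF i] by (simp add: sum_distrib_right sum_negf mult.assoc)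
  also have "\<dots> = - (\<Sum>t \<in> tets_at i. sgn (oriented_volume T orn x t) *
      (\<Sum>j \<in> edges T. angle_partial t i j * length_rate V j))"
    by (subst sum.swap) (simp add: sum_distrib_left)
  also have "\<dots> = - (\<Sum>t \<in> tets_at i. sgn (oriented_volume T orn x t) *
      (\<Sum>j \<in> {e \<in> edges T. is_face T e t}. angle_partial t i j * length_rate V j))"
  proof -
    have "(\<Sum>j \<in> edges T. angle_partial t i j * length_rate V j)
        = (\<Sum>j \<in> {e \<in> edges T. is_face T e t}. angle_partial t i j * length_rate V j)"
      if "t \<in> tets_at i" for t
      using that i finite_edges angle_partial_nonface
      by (intro sum.mono_neutral_right) (auto simp: tets_at_def)
    then show ?thesis by simp
  qed
  also have "\<dots> = 0" using signed_angle_sum_stationary[OF V i] by simp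
  finally show ?thesis .
qed

section \<open>The basis motions\<close>

lemma velocity_boundary_rigid:
  assumes "q \<in> motion_index T M"
  shows "boundary_rigid (velocity T x q)"
  unfolding boundary_rigid_def
proof
  fix c assume c: "c \<in> bdry_components M"
  show "\<exists>b \<omega>. \<forall>Z. vertex_in T Z c \<longrightarrow> velocity T x q Z = b + \<omega> \<times> x Z"
  proof (cases q)
    case (Inl p)
    then obtain A k where p: "q = Inl (A, k)" "A \<in> inner_vertices T M"
      using assms by (cases p) (auto simp: motion_index_def)
    then have "velocity T x q Z = 0 + 0 \<times> x Z" if "vertex_in T Z c" for Z
      using that inner_vertex_not_in_component c by auto
    then show ?thesis by blast
  next
    case (Inr p)
    then obtain c' g where p: "q = Inr (c', g)" "c' \<in> bdry_components M"
      using assms by (cases p) (auto simp: motion_index_def)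
    show ?thesis
    proof (cases "c' = c")
      case False
      then have "velocity T x q Z = 0 + 0 \<times> x Z" if "vertex_in T Z c" for Z
        using that vertex_component_unique c p by auto
      then show ?thesis by blast
    next
      case True
      show ?thesis
      proof (cases g)
        case (Inl k)
        then have "velocity T x q Z = axis k 1 + 0 \<times> x Z" if "vertex_in T Z c" for Z
          using that p True by simp
        then show ?thesis by blast
      next
        case (Inr k)
        then have "velocity T x q Z = 0 + axis k 1 \<times> x Z" if "vertex_in T Z c" for Z
          using that p True by simp
        then show ?thesis by blast
      qed
    qed
  qed
qed

lemma F3_F2:
  assumes "i \<in> edges T" "q \<in> motion_index T M" and C: "C \<subseteq> bdry_edges T M"
  shows "(\<Sum>j \<in> edge_index T M C. F3 T M orn x i j * F2 T x j q) = 0"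
proof -
  have "(\<Sum>j \<in> edge_index T M C. F3 T M orn x i j * F2 T x j q)
      = (\<Sum>j \<in> edges T. F3 T M orn x i j * F2 T x j q)"
    using finite_edges C boundary_edge_length_rate[OF velocity_boundary_rigid[OF assms(2)]]
    by (intro sum.mono_neutral_left)
       (auto simp: edge_index_def inner_edges_def bdry_edges_def F2_eq_length_rate)
  then show ?thesis
    using F3_length_rate[OF velocity_boundary_rigid[OF assms(2)] assms(1)]
    by (simp add: F2_eq_length_rate)
qed

unbundle no cross3_syntax

text \<open>
  The column of \<open>f1\<close> for a basis element \<open>g\<close> moves every vertex as \<open>g\<close> does. An inner vertex receives
  its displacement in coordinates, and any other vertex that of the single boundary component
  on which it lies.
\<close>

lemma F1_velocity:
  assumes Z: "Z \<in> vertices T"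
  shows "(\<Sum>q \<in> motion_index T M. F1 x q g *\<^sub>R velocity T x q Z) = e3_field g (x Z)"
proof -
  have fin: "finite (inner_vertices T M \<times> (UNIV :: 3 set))"
    "finite (bdry_components M \<times> (UNIV :: e3_basis set))"
    using finite_inner_vertices finite_components by auto
  have basis: "(\<Sum>k\<in>UNIV. y $ k *\<^sub>R axis k 1) = y" for y :: "real ^ 3"
    by (metis basis_expansion scalar_mult_eq_scaleR)
  have inner: "(\<Sum>p \<in> inner_vertices T M \<times> UNIV. F1 x (Inl p) g *\<^sub>R velocity T x (Inl p) Z)
      = (if Z \<in> inner_vertices T M then e3_field g (x Z) else 0)"
  proof -
    have "(\<Sum>p \<in> inner_vertices T M \<times> UNIV. F1 x (Inl p) g *\<^sub>R velocity T x (Inl p) Z)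
      = (\<Sum>A \<in> inner_vertices T M. \<Sum>k \<in> UNIV. (e3_field g (x A) $ k) *\<^sub>R (if Z = A then axis k 1 else 0))"
      unfolding sum.cartesian_product by (intro sum.cong) (auto simp del: scaleR_eq_0_iff)
    also have "\<dots> = (\<Sum>A \<in> inner_vertices T M. if Z = A then e3_field g (x A) else 0)"
      by (intro sum.cong) (auto simp: basis)
    finally show ?thesis using finite_inner_vertices by simp
  qed
  have outer: "(\<Sum>p \<in> bdry_components M \<times> UNIV. F1 x (Inr p) g *\<^sub>R velocity T x (Inr p) Z)
      = (\<Sum>c \<in> bdry_components M. if vertex_in T Z c then e3_field g (x Z) else 0)"
  proof -
    have "(\<Sum>p \<in> bdry_components M \<times> UNIV. F1 x (Inr p) g *\<^sub>R velocity T x (Inr p) Z)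
      = (\<Sum>c \<in> bdry_components M. \<Sum>h \<in> UNIV. (if h = g then 1 else 0) *\<^sub>R (if vertex_in T Z c then e3_field h (x Z) else 0))"
      unfolding sum.cartesian_product by (intro sum.cong) auto
    also have "\<dots> = (\<Sum>c \<in> bdry_components M. \<Sum>h \<in> UNIV. if h = g then (if vertex_in T Z c then e3_field g (x Z) else 0) else 0)"
      by (intro sum.cong) auto
    finally show ?thesis by simp
  qed
  have "(\<Sum>q \<in> motion_index T M. F1 x q g *\<^sub>R velocity T x q Z)
      = (if Z \<in> inner_vertices T M then e3_field g (x Z) else 0)
      + (\<Sum>c \<in> bdry_components M. if vertex_in T Z c then e3_field g (x Z) else 0)"
    unfolding motion_index_def sum.Plus[OF fin] o_def inner outer ..
  also have "\<dots> = e3_field g (x Z)"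
  proof (cases "Z \<in> inner_vertices T M")
    case True
    then show ?thesis using inner_vertex_not_in_component by (simp add: sum.neutral)
  next
    case False
    then obtain c where c: "c \<in> bdry_components M" "vertex_in T Z c"
      using outer_vertex_in_component Z by blast
    then have "(\<Sum>c \<in> bdry_components M. if vertex_in T Z c then e3_field g (x Z) else 0)
        = (\<Sum>c' \<in> bdry_components M. if c' = c then e3_field g (x Z) else 0)"
      using vertex_component_unique by (intro sum.cong) auto
    then show ?thesis using False c(1) finite_components by simp
  qed
  finally show ?thesis .
qed

text \<open>
  The relative velocity of the ends of an edge under an infinitesimal isometry is perpendicular to the edge.
\<close>

lemma F2_F1:
  assumes i: "i \<in> edges T"
  shows "(\<Sum>q \<in> motion_index T M. F2 T x i q * F1 x q g) = 0"
proof -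
  obtain A B where AB: "verts T i = {A, B}" using edge_verts[OF i] by blast
  then have v: "A \<in> vertices T" "B \<in> vertices T" using i by (auto simp: vertices_def edges_def)
  have "(\<Sum>q \<in> motion_index T M. F2 T x i q * F1 x q g)
      = ((x A - x B) \<bullet> ((\<Sum>q \<in> motion_index T M. F1 x q g *\<^sub>R velocity T x q A)
          - (\<Sum>q \<in> motion_index T M. F1 x q g *\<^sub>R velocity T x q B))) / dist (x A) (x B)"
    unfolding F2_eq_length_rate length_rate_has_derivative(1)[OF i AB]
    by (simp add: inner_diff_right inner_sum_right sum_divide_distrib flip: sum_subtractf)
       (simp add: algebra_simps diff_divide_distrib)
  also have "\<dots> = 0"
    unfolding F1_velocity[OF v(1)] F1_velocity[OF v(2)]
    by (cases g) (simp_all add: dot_cross_self flip: Cross3.right_diff_distrib)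
  finally show ?thesis .
qed

end

section \<open>The complex\<close>

lemma mat_map_compose_zero:
  assumes "\<And>i k. i \<in> I \<Longrightarrow> k \<in> K \<Longrightarrow> (\<Sum>j \<in> J. A i j * B j k) = 0"
  shows "mat_map I J A (mat_map J K B v) = (\<lambda>_. 0)"
proof
  fix i
  have "(\<Sum>j\<in>J. A i j * (\<Sum>k\<in>K. B j k * v k)) = (\<Sum>k\<in>K. (\<Sum>j\<in>J. A i j * B j k) * v k)"
    by (simp add: sum_distrib_left sum_distrib_right mult.assoc) (rule sum.swap)
  also have "\<dots> = 0" if "i \<in> I" using assms that by simp
  finally show "mat_map I J A (mat_map J K B v) i = 0"
    by (auto simp: mat_map_def)
qed

theorem theorem1:
  fixes M :: "'p topology"
    and T :: "('p, 'v, 'c) triang"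
    and orn :: "'c \<Rightarrow> 'v list \<Rightarrow> int"
    and x :: "'v \<Rightarrow> real ^ 3"
    and \<C> \<D> :: "'c set"
    and m :: nat
  assumes "manifold3 M" and "compact_space M" and "connected_space M"
    and "triangulates T M"
    and "orients orn T"
    and "finite (bdry_components M)" and "card (bdry_components M) = m"
    and "generic_coords T orn x"
    and "\<C> \<subseteq> bdry_edges T M" and "\<D> \<subseteq> bdry_edges T M" and "card \<C> = card \<D>"
  shows "(\<forall>a \<in> colvecs e3_index. (f2 T M x \<C> \<circ> f1 T M x) a = (\<lambda>_. 0)) \<and>
    (\<forall>u \<in> colvecs (motion_index T M). (f3 T M orn x \<C> \<D> \<circ> f2 T M x \<C>) u = (\<lambda>_. 0)) \<and>
    (\<forall>dl \<in> colvecs (edge_index T M \<C>). (f4 T M x \<D> \<circ> f3 T M orn x \<C> \<D>) dl = (\<lambda>_. 0)) \<and>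
    (\<forall>dw \<in> colvecs (edge_index T M \<D>). (f5 T M x \<circ> f4 T M x \<D>) dw = (\<lambda>_. 0))"
proof -
  interpret generic_manifold M T orn x
    using assms by unfold_locales
  have sub: "edge_index T M E \<subseteq> edges T" if "E \<subseteq> bdry_edges T M" for E
    using that by (auto simp: edge_index_def inner_edges_def bdry_edges_def)
  have 1: "f2 T M x \<C> (f1 T M x a) = (\<lambda>_. 0)" for a
    unfolding f1_def f2_def using F2_F1 sub[OF assms(9)] by (intro mat_map_compose_zero) blast
  have 2: "f3 T M orn x \<C> \<D> (f2 T M x \<C> u) = (\<lambda>_. 0)" for u
    unfolding f2_def f3_def using F3_F2 sub[OF assms(10)] assms(9) by (intro mat_map_compose_zero) blast
  have 3: "f4 T M x \<D> (f3 T M orn x \<C> \<D> dl) = (\<lambda>_. 0)" for dl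
    unfolding f3_def f4_def
  proof (rule mat_map_compose_zero)
    fix q j assume q: "q \<in> motion_index T M" and j: "j \<in> edge_index T M \<C>"
    have je: "j \<in> edges T" using sub[OF assms(9)] j by blast
    have "(\<Sum>i \<in> edge_index T M \<D>. - F2 T x i q * F3 T M orn x i j)
        = - (\<Sum>i \<in> edge_index T M \<D>. F3 T M orn x j i * F2 T x i q)"
      unfolding sum_negf[symmetric] using F3_symmetric[OF je] sub[OF assms(10)]
      by (intro sum.cong) (auto simp: subset_iff)
    then show "(\<Sum>i \<in> edge_index T M \<D>. - F2 T x i q * F3 T M orn x i j) = 0"
      using F3_F2[OF je q assms(10)] by simp
  qed
  have 4: "f5 T M x (f4 T M x \<D> dw) = (\<lambda>_. 0)" for dw
    unfolding f4_def f5_def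
  proof (rule mat_map_compose_zero)
    fix g i assume i: "i \<in> edge_index T M \<D>"
    then have "(\<Sum>q \<in> motion_index T M. F2 T x i q * F1 x q g) = 0"
      using F2_F1 sub[OF assms(10)] by blast
    then show "(\<Sum>q \<in> motion_index T M. F1 x q g * - F2 T x i q) = 0"
      by (simp add: sum_negf mult.commute)
  qed
  show ?thesis using 1 2 3 4 by simp
qed

end
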